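(* Let $\mathrm N_{n,2}=F_n/\gamma_3F_n$ be the free nilpotent group of rank $n$ and step $2$ with basis $x_1,\dots,x_n$. The group $\Pi A(\mathrm N_{n,2})$ of palindromic automorphisms of $\mathrm N_{n,2}$ is generated by the automorphisms $t_i$ ($1\le i\le n$), $\alpha_{l,l+1}$ ($1\le l\le n-1$) and $\mu_{ij}$ ($1\le i\ne j\le n$), where $$t_i:\ x_i\mapsto x_i^{-1},\quad x_k\mapsto x_k\ (k\ne i),$$ $$\alpha_{l,l+1}:\ x_l\mapsto x_{l+1},\quad x_{l+1}\mapsto x_l,\quad x_k\mapsto x_k\ (k\neq l,l+1),$$ $$\mu_{ij}:\ x_i\mapsto x_jx_ix_j,\quad x_k\mapsto x_k\ (k\ne i).$$
   Context: $F_n$ is the free group on $x_1,\dots,x_n$ and $\gamma_3F_n=[[F_n,F_n],F_n]$; the images of the $x_i$ in $\mathrm N_{n,2}$ are again denoted $x_i$. A word in $x_1^{\pm1},\dots,x_n^{\pm1}$ is a palindrome if it coincides letter by letter with its reverse word; an element of $\mathrm N_{n,2}$ is a palindrome if it is represented by some palindromic word. An automorphism $\phi$ of $\mathrm N_{n,2}$ is palindromic if the image $x_i^{\phi}$ is a palindrome for every $1\le i\le n$; $\Pi A(\mathrm N_{n,2})$ is the set of all palindromic automorphisms, which is a group under composition. *)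

theory Defs
  imports "HOL-Algebra.Algebra"
begin

subsection \<open>Free groups\<close>

text \<open>The letter \<open>(i, True)\<close> stands for \<open>x\<^sub>i\<close> and \<open>(i, False)\<close> for its inverse.\<close>

type_synonym letter = "nat \<times> bool"
type_synonym word = "letter list"

definition inv_letter :: "letter \<Rightarrow> letter" where
  "inv_letter a = (fst a, \<not> snd a)"

definition words :: "nat \<Rightarrow> word set" where
  "words n = lists ({1..n} \<times> UNIV)"

definition reduced :: "word \<Rightarrow> bool" where
  "reduced w \<longleftrightarrow> successively (\<lambda>a b. b \<noteq> inv_letter a) w"

fun cons_red :: "letter \<Rightarrow> word \<Rightarrow> word" where
  "cons_red a [] = [a]"
| "cons_red a (b # w) = (if b = inv_letter a then w else a # b # w)"

definition reduce :: "word \<Rightarrow> word" where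
  "reduce w = foldr cons_red w []"

definition free_group :: "nat \<Rightarrow> word monoid" where
  "free_group n =
     \<lparr>carrier = {w \<in> words n. reduced w}, monoid.mult = (\<lambda>u v. reduce (u @ v)), one = []\<rparr>"

lemma inv_letter_inv_letter [simp]: "inv_letter (inv_letter a) = a"
  by (simp add: inv_letter_def)

lemma reduced_Nil [simp]: "reduced []"
  by (simp add: reduced_def)

lemma reduced_ConsD: "reduced (a # w) \<Longrightarrow> reduced w"
  by (cases w) (auto simp: reduced_def)

lemma reduced_cons_red: "reduced w \<Longrightarrow> reduced (cons_red a w)"
  by (cases w) (auto simp: reduced_def successively_Cons)

lemma cons_red_cancel: "reduced w \<Longrightarrow> cons_red (inv_letter a) (cons_red a w) = w"
  by (cases w; cases "tl w") (auto simp: reduced_def successively_Cons)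

lemma cons_red_cancel': "reduced w \<Longrightarrow> cons_red a (cons_red (inv_letter a) w) = w"
  using cons_red_cancel[of w "inv_letter a"] by simp

lemma reduced_foldr: "reduced v \<Longrightarrow> reduced (foldr cons_red u v)"
  by (induction u) (auto intro: reduced_cons_red)

lemma reduced_reduce: "reduced (reduce w)"
  by (simp add: reduce_def reduced_foldr)

lemma reduce_reduced: "reduced w \<Longrightarrow> reduce w = w"
proof (induction w)
  case (Cons a w)
  then show ?case
    by (cases w) (auto simp: reduce_def reduced_def)
qed (simp add: reduce_def)

lemma foldr_cons_red:
  "reduced v \<Longrightarrow> foldr cons_red (cons_red a u) v = cons_red a (foldr cons_red u v)"
  by (cases u) (auto simp: cons_red_cancel' reduced_foldr)

lemma foldr_reduce: "reduced v \<Longrightarrow> foldr cons_red (reduce u) v = foldr cons_red u v"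
  by (induction u) (auto simp: reduce_def foldr_cons_red)

lemma reduce_append_left: "reduce (reduce u @ v) = reduce (u @ v)"
  by (simp add: reduce_def[of "_ @ _"] foldr_reduce reduced_foldr)

lemma reduce_append_right: "reduce (u @ reduce v) = reduce (u @ v)"
  using reduce_reduced[OF reduced_reduce, of v] by (simp add: reduce_def)

lemma set_cons_red: "set (cons_red a w) \<subseteq> insert a (set w)"
  by (cases w) auto

lemma set_reduce: "set (reduce w) \<subseteq> set w"
proof (induction w)
  case (Cons a w)
  then show ?case
    using set_cons_red[of a "reduce w"] by (auto simp: reduce_def)
qed (simp add: reduce_def)

lemma words_Nil [simp]: "[] \<in> words n"
  by (simp add: words_def)

lemma words_append [simp]: "u @ v \<in> words n \<longleftrightarrow> u \<in> words n \<and> v \<in> words n"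
  by (simp add: words_def)

lemma reduce_words: "w \<in> words n \<Longrightarrow> reduce w \<in> words n"
  using set_reduce by (fastforce simp: words_def in_lists_conv_set)

lemma foldr_inverse: "reduced v \<Longrightarrow> foldr cons_red (rev (map inv_letter w)) (foldr cons_red w v) = v"
  by (induction w arbitrary: v) (auto simp: cons_red_cancel reduced_foldr)

lemma reduce_inverse: "reduce (rev (map inv_letter w) @ w) = []"
  using foldr_inverse[of "[]" w] by (simp add: reduce_def)

lemma group_free_group: "group (free_group n)"
proof (rule groupI)
  fix w assume w: "w \<in> carrier (free_group n)"
  have "rev (map inv_letter w) \<in> words n"
    using w by (fastforce simp: free_group_def words_def in_lists_conv_set inv_letter_def)
  then have "reduce (rev (map inv_letter w)) \<in> carrier (free_group n)"
    by (simp add: free_group_def reduced_reduce reduce_words)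
  then show "\<exists>y\<in>carrier (free_group n). y \<otimes>\<^bsub>free_group n\<^esub> w = \<one>\<^bsub>free_group n\<^esub>"
    by (intro bexI[of _ "reduce (rev (map inv_letter w))"])
      (simp_all add: free_group_def reduce_append_left reduce_inverse)
qed (auto simp: free_group_def reduced_reduce reduce_reduced reduce_append_left
      reduce_append_right intro!: reduce_words)


subsection \<open>Free nilpotent groups of step 2\<close>

definition commutator_subgroup :: "('a, 'b) monoid_scheme \<Rightarrow> 'a set \<Rightarrow> 'a set \<Rightarrow> 'a set" where
  "commutator_subgroup G H K =
     generate G {h \<otimes>\<^bsub>G\<^esub> k \<otimes>\<^bsub>G\<^esub> inv\<^bsub>G\<^esub> h \<otimes>\<^bsub>G\<^esub> inv\<^bsub>G\<^esub> k | h k. h \<in> H \<and> k \<in> K}"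

definition gamma3 :: "('a, 'b) monoid_scheme \<Rightarrow> 'a set" where
  "gamma3 G = commutator_subgroup G (commutator_subgroup G (carrier G) (carrier G)) (carrier G)"

definition free_nil2 :: "nat \<Rightarrow> word set monoid" where
  "free_nil2 n = free_group n Mod gamma3 (free_group n)"

definition repr :: "nat \<Rightarrow> word \<Rightarrow> word set" where
  "repr n w = gamma3 (free_group n) #>\<^bsub>free_group n\<^esub> reduce w"

abbreviation gen :: "nat \<Rightarrow> nat \<Rightarrow> word set" where
  "gen n i \<equiv> repr n [(i, True)]"

lemma (in group) commutator_subgroup_normal:
  assumes "H \<lhd> G" "K \<lhd> G"
  shows "commutator_subgroup G H K \<lhd> G"
  unfolding commutator_subgroup_def
proof (rule normal_generateI)
  note HK = normal_imp_subgroup[OF assms(1), THEN subgroup.mem_carrier]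
    normal_imp_subgroup[OF assms(2), THEN subgroup.mem_carrier]
  show "{h \<otimes> k \<otimes> inv h \<otimes> inv k | h k. h \<in> H \<and> k \<in> K} \<subseteq> carrier G"
    using HK by auto
  fix c g
  assume "c \<in> {h \<otimes> k \<otimes> inv h \<otimes> inv k | h k. h \<in> H \<and> k \<in> K}" and g: "g \<in> carrier G"
  then obtain h k where c: "c = h \<otimes> k \<otimes> inv h \<otimes> inv k" and h: "h \<in> H" and k: "k \<in> K"
    by auto
  note carr = HK(1)[OF h] HK(2)[OF k] g
  have cancel: "inv g \<otimes> (g \<otimes> y) = y" if "y \<in> carrier G" for y
    using that g by (simp add: m_assoc[symmetric])
  have "g \<otimes> c \<otimes> inv g =
      (g \<otimes> h \<otimes> inv g) \<otimes> (g \<otimes> k \<otimes> inv g) \<otimes> inv (g \<otimes> h \<otimes> inv g) \<otimes> inv (g \<otimes> k \<otimes> inv g)"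
    using carr by (simp add: c m_assoc inv_mult_group cancel)
  moreover have "g \<otimes> h \<otimes> inv g \<in> H" "g \<otimes> k \<otimes> inv g \<in> K"
    using assms h k g by (auto intro: normal.inv_op_closed2)
  ultimately show "g \<otimes> c \<otimes> inv g \<in> {h \<otimes> k \<otimes> inv h \<otimes> inv k | h k. h \<in> H \<and> k \<in> K}"
    by blast
qed

lemma (in group) gamma3_normal: "gamma3 G \<lhd> G"
  unfolding gamma3_def by (intro commutator_subgroup_normal normal_self)

lemma group_free_nil2: "group (free_nil2 n)"
  unfolding free_nil2_def
  by (rule normal.factorgroup_is_group[OF group.gamma3_normal[OF group_free_group]])


subsection \<open>Palindromic automorphisms\<close>

definition palindrome :: "nat \<Rightarrow> word set \<Rightarrow> bool" where
  "palindrome n g \<longleftrightarrow> (\<exists>w \<in> words n. rev w = w \<and> g = repr n w)"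

definition palindromic_auts :: "nat \<Rightarrow> (word set \<Rightarrow> word set) set" where
  "palindromic_auts n =
     {\<phi> \<in> auto (free_nil2 n). \<forall>i \<in> {1..n}. palindrome n (\<phi> (gen n i))}"

text \<open>An automorphism is determined by the images of the basis; uniqueness in \<^term>\<open>The\<close> also
  uses that members of \<^term>\<open>auto G\<close> are extensional.\<close>

definition basis_aut :: "nat \<Rightarrow> (nat \<Rightarrow> word set) \<Rightarrow> word set \<Rightarrow> word set" where
  "basis_aut n y = (THE \<phi>. \<phi> \<in> auto (free_nil2 n) \<and> (\<forall>k \<in> {1..n}. \<phi> (gen n k) = y k))"

definition t_aut :: "nat \<Rightarrow> nat \<Rightarrow> word set \<Rightarrow> word set" where
  "t_aut n i = basis_aut n ((gen n)(i := inv\<^bsub>free_nil2 n\<^esub> (gen n i)))"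

definition alpha_aut :: "nat \<Rightarrow> nat \<Rightarrow> word set \<Rightarrow> word set" where
  "alpha_aut n l = basis_aut n ((gen n)(l := gen n (l + 1), l + 1 := gen n l))"

definition mu_aut :: "nat \<Rightarrow> nat \<Rightarrow> nat \<Rightarrow> word set \<Rightarrow> word set" where
  "mu_aut n i j =
     basis_aut n ((gen n)(i := gen n j \<otimes>\<^bsub>free_nil2 n\<^esub> gen n i \<otimes>\<^bsub>free_nil2 n\<^esub> gen n j))"

end

theory Submission
  imports Defs
begin

text \<open>
  Write \<open>N\<close> for the free nilpotent group of step 2 and \<open>\<int>\<^sup>n\<close> for its abelianisation. Two facts carry
  the proof.

  Palindromes in \<open>N\<close> are determined by their exponent sums. In a group whose commutators are central,
  the maps \<open>g \<mapsto> x g x\<close> for different \<open>x\<close> commute (\<open>sandwich_commute\<close>). A palindromic word arises from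
  the empty word or a single letter by such maps, one for each letter of its first half, so only the
  exponent sums of that half matter (\<open>sandwich_eq_if_exponents_zero\<close>). Hence a palindromic
  automorphism is determined by the integer matrix that it induces on \<open>\<int>\<^sup>n\<close>, whose row \<open>i\<close> holds the
  exponent sums of the image of \<open>x\<^sub>i\<close>; what is needed of this is that the identity matrix comes from the
  identity only (\<open>palindromic_aut_eq_one\<close>).

  The matrices that occur are invertible over the integers, and every row has at most one odd entry,
  because a letter outside the middle of a palindrome occurs together with its mirror image. Composing on
  the right with \<open>\<mu>\<^sub>i\<^sub>j\<close>, \<open>t\<^sub>i\<close> and \<open>\<alpha>\<^sub>l\<^sub>,\<^sub>l\<^sub>+\<^sub>1\<close> adds twice row \<open>j\<close> to row \<open>i\<close>, negates row \<open>i\<close> and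
  swaps rows \<open>l\<close> and \<open>l + 1\<close>. These operations reduce such a matrix to the identity by a Euclidean
  algorithm with even quotients (\<open>identity_reached\<close>). The algorithm cannot stall: it would do so only
  at two entries of a column with equal absolute value, which is then 1, the rows spanning \<open>\<int>\<^sup>n\<close>; but
  invertibility also forces every column to have just one odd entry. So every palindromic automorphism \<open>\<phi>\<close>
  satisfies \<open>\<phi> \<circ> h = id\<close> for some \<open>h\<close> in the subgroup generated by the elementary automorphisms.

  The elementary automorphisms exist because \<open>N\<close> has the universal property for groups with central
  commutators (\<open>free_nil2_universal\<close>). The subgroup that they generate consists of palindromic
  automorphisms, because a homomorphism that maps the basis to palindromes maps palindromes to
  palindromes (\<open>palindrome_hom_image\<close>).
\<close>

section \<open>Evaluating words in a group\<close>

definition (in group) letter_val :: "(nat \<Rightarrow> 'a) \<Rightarrow> letter \<Rightarrow> 'a" where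
  "letter_val f a = (if snd a then f (fst a) else inv f (fst a))"

definition (in group) word_val :: "(nat \<Rightarrow> 'a) \<Rightarrow> word \<Rightarrow> 'a" where
  "word_val f w = foldr (\<lambda>a g. letter_val f a \<otimes> g) w \<one>"

lemma words_Cons [simp]: "a # w \<in> words n \<longleftrightarrow> fst a \<in> {1..n} \<and> w \<in> words n"
  by (cases a) (auto simp: words_def)

lemma words_rev [simp]: "rev w \<in> words n \<longleftrightarrow> w \<in> words n"
  by (simp add: words_def in_lists_conv_set)

context group
begin

lemma word_val_Nil [simp]: "word_val f [] = \<one>"
  and word_val_Cons [simp]: "word_val f (a # w) = letter_val f a \<otimes> word_val f w"
  by (simp_all add: word_val_def)

lemma letter_val_closed [simp]:
  "\<lbrakk>f \<in> {1..n} \<rightarrow> carrier G; fst a \<in> {1..n}\<rbrakk> \<Longrightarrow> letter_val f a \<in> carrier G"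
  by (simp add: letter_val_def Pi_iff)

lemma word_val_closed [simp]:
  "\<lbrakk>f \<in> {1..n} \<rightarrow> carrier G; w \<in> words n\<rbrakk> \<Longrightarrow> word_val f w \<in> carrier G"
  by (induction w) auto

lemma word_val_append:
  assumes f: "f \<in> {1..n} \<rightarrow> carrier G"
  shows "\<lbrakk>u \<in> words n; v \<in> words n\<rbrakk> \<Longrightarrow> word_val f (u @ v) = word_val f u \<otimes> word_val f v"
  by (induction u) (auto simp: m_assoc word_val_closed[OF f] letter_val_closed[OF f])

lemma letter_val_inv_letter:
  "\<lbrakk>f \<in> {1..n} \<rightarrow> carrier G; fst a \<in> {1..n}\<rbrakk> \<Longrightarrow> letter_val f (inv_letter a) = inv (letter_val f a)"
  by (auto simp: letter_val_def inv_letter_def Pi_iff)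

text \<open>Cancelling a pair of mutually inverse letters does not change the value, so evaluation descends from
  words to the free group.\<close>

lemma word_val_reduce:
  assumes f: "f \<in> {1..n} \<rightarrow> carrier G"
  shows "w \<in> words n \<Longrightarrow> word_val f (reduce w) = word_val f w"
proof (induction w)
  case (Cons a w)
  have cons_red: "word_val f (cons_red a v) = letter_val f a \<otimes> word_val f v" if "v \<in> words n" for v
  proof (cases v)
    case (Cons b u)
    then show ?thesis
      using that \<open>a # w \<in> words n\<close> f
      by (auto simp: letter_val_inv_letter simp flip: m_assoc)
  qed simp
  show ?case
    using Cons cons_red[OF reduce_words] by (simp add: reduce_def)
qed (simp add: reduce_def)

lemma word_val_hom_free_group:
  assumes "f \<in> {1..n} \<rightarrow> carrier G"
  shows "word_val f \<in> hom (free_group n) G"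
  using assms by (intro homI) (auto simp: free_group_def word_val_reduce word_val_append)

end

lemma (in group_hom) hom_word_val:
  assumes f: "f \<in> {1..n} \<rightarrow> carrier G"
  shows "w \<in> words n \<Longrightarrow> h (G.word_val f w) = H.word_val (h \<circ> f) w"
proof (induction w)
  case (Cons a w)
  then show ?case
    using f by (auto simp: G.letter_val_def H.letter_val_def Pi_iff)
qed simp



section \<open>The universal property of the free nilpotent group of step 2\<close>

lemma (in group) inv_mult_cancel [simp]:
  assumes "x \<in> carrier G" "y \<in> carrier G"
  shows "inv x \<otimes> (x \<otimes> y) = y" "x \<otimes> (inv x \<otimes> y) = y"
  using assms by (simp_all flip: m_assoc)

lemma (in group) commute_if_commutator_one:
  assumes "x \<in> carrier G" "y \<in> carrier G" "x \<otimes> y \<otimes> inv x \<otimes> inv y = \<one>"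
  shows "x \<otimes> y = y \<otimes> x"
proof -
  have "x \<otimes> y = x \<otimes> y \<otimes> inv x \<otimes> inv y \<otimes> (y \<otimes> x)"
    using assms(1,2) by (simp add: m_assoc)
  then show ?thesis
    using assms by simp
qed

text \<open>Nilpotency of class at most 2, in the form in which it is used.\<close>

definition (in group) central_commutators :: bool where
  "central_commutators \<longleftrightarrow> (\<forall>x \<in> carrier G. \<forall>y \<in> carrier G. \<forall>z \<in> carrier G.
     (x \<otimes> y \<otimes> inv x \<otimes> inv y) \<otimes> z = z \<otimes> (x \<otimes> y \<otimes> inv x \<otimes> inv y))"

lemma (in group) centralizer_subgroup:
  assumes "z \<in> carrier G"
  shows "subgroup {x \<in> carrier G. x \<otimes> z = z \<otimes> x} G"
proof (rule subgroupI)
  fix x y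
  assume "x \<in> {x \<in> carrier G. x \<otimes> z = z \<otimes> x}" "y \<in> {x \<in> carrier G. x \<otimes> z = z \<otimes> x}"
  then show "x \<otimes> y \<in> {x \<in> carrier G. x \<otimes> z = z \<otimes> x}"
    using assms by (auto simp: m_assoc) (simp flip: m_assoc)
next
  fix x
  assume x: "x \<in> {x \<in> carrier G. x \<otimes> z = z \<otimes> x}"
  then have "inv x \<otimes> z = inv x \<otimes> (z \<otimes> x) \<otimes> inv x"
    using assms by (simp only: m_assoc mem_Collect_eq inv_closed m_closed r_inv r_one)
  also have "\<dots> = inv x \<otimes> (x \<otimes> z) \<otimes> inv x"
    using x by simp
  also have "\<dots> = z \<otimes> inv x"
    by (subst inv_mult_cancel(1)) (use x assms in auto)
  finally have "inv x \<otimes> z = z \<otimes> inv x" .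
  then show "inv x \<in> {x \<in> carrier G. x \<otimes> z = z \<otimes> x}"
    using x by simp
qed (use assms in auto)

lemma (in group_hom) vimage_subgroup:
  assumes "subgroup K H"
  shows "subgroup {x \<in> carrier G. h x \<in> K} G"
proof -
  interpret K: subgroup K H by fact
  show ?thesis
  proof (rule G.subgroupI)
    have "\<one> \<in> {x \<in> carrier G. h x \<in> K}"
      by simp
    then show "{x \<in> carrier G. h x \<in> K} \<noteq> {}"
      by blast
  qed auto
qed

text \<open>The image of the commutator subgroup centralises each \<open>z\<close> in the target, since its generators map to
  commutators and the centraliser of \<open>z\<close> is a subgroup. So the generators of \<open>\<gamma>\<^sub>3\<close> die.\<close>

lemma (in group_hom) hom_gamma3:
  assumes cc: "H.central_commutators" and x: "x \<in> gamma3 G"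
  shows "h x = \<one>\<^bsub>H\<^esub>"
proof -
  have comm: "h x \<otimes>\<^bsub>H\<^esub> z = z \<otimes>\<^bsub>H\<^esub> h x"
    if x: "x \<in> commutator_subgroup G (carrier G) (carrier G)" and z: "z \<in> carrier H" for x z
  proof -
    have "commutator_subgroup G (carrier G) (carrier G) \<subseteq>
        {x \<in> carrier G. h x \<in> {x \<in> carrier H. x \<otimes>\<^bsub>H\<^esub> z = z \<otimes>\<^bsub>H\<^esub> x}}"
      unfolding commutator_subgroup_def
      by (rule G.generate_subgroup_incl[OF _ vimage_subgroup[OF H.centralizer_subgroup[OF z]]])
        (use cc z in \<open>auto simp: H.central_commutators_def\<close>)
    then show ?thesis using x by auto
  qed
  have sub: "commutator_subgroup G (carrier G) (carrier G) \<subseteq> carrier G"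
    using G.commutator_subgroup_normal[OF G.normal_self G.normal_self]
    by (simp add: normal_imp_subgroup subgroup.subset)
  have "gamma3 G \<subseteq> kernel G H h"
    unfolding gamma3_def commutator_subgroup_def[of _ "commutator_subgroup _ _ _"]
  proof (rule G.generate_subgroup_incl[OF _ subgroup_kernel], safe)
    fix x k
    assume x: "x \<in> commutator_subgroup G (carrier G) (carrier G)" and k: "k \<in> carrier G"
    have [simp]: "x \<in> carrier G" using x sub by auto
    have "h (x \<otimes> k \<otimes> inv x \<otimes> inv k) = \<one>\<^bsub>H\<^esub>"
      using k comm[OF x, of "h k"] by (simp add: H.m_assoc)
    then show "x \<otimes> k \<otimes> inv x \<otimes> inv k \<in> kernel G H h"
      using k by (simp add: kernel_def)
  qed
  then show ?thesis
    using x by (auto simp: kernel_def)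
qed

lemma repr_mult:
  assumes "u \<in> words n" "v \<in> words n"
  shows "repr n u \<otimes>\<^bsub>free_nil2 n\<^esub> repr n v = repr n (u @ v)"
proof -
  interpret F: group "free_group n" by (rule group_free_group)
  interpret normal "gamma3 (free_group n)" "free_group n" by (rule F.gamma3_normal)
  have "reduce u \<in> carrier (free_group n)" "reduce v \<in> carrier (free_group n)"
    using assms by (auto simp: free_group_def reduced_reduce reduce_words)
  then show ?thesis
    using rcos_sum[of "reduce u" "reduce v"]
    by (simp add: repr_def free_nil2_def free_group_def reduce_append_left reduce_append_right)
qed

lemma carrier_free_nil2: "carrier (free_nil2 n) = repr n ` words n"
proof (intro equalityI subsetI)
  fix x assume "x \<in> carrier (free_nil2 n)"
  then obtain w where w: "w \<in> carrier (free_group n)" "x = gamma3 (free_group n) #>\<^bsub>free_group n\<^esub> w"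
    by (auto simp: free_nil2_def carrier_FactGroup)
  then have "w \<in> words n" "x = repr n w"
    by (simp_all add: free_group_def repr_def reduce_reduced)
  then show "x \<in> repr n ` words n"
    by blast
next
  fix x assume "x \<in> repr n ` words n"
  then obtain w where w: "w \<in> words n" "x = repr n w"
    by blast
  moreover have "reduce w \<in> carrier (free_group n)"
    using w by (simp add: free_group_def reduced_reduce reduce_words)
  ultimately show "x \<in> carrier (free_nil2 n)"
    by (auto simp: free_nil2_def carrier_FactGroup repr_def)
qed

lemma repr_closed [simp]: "w \<in> words n \<Longrightarrow> repr n w \<in> carrier (free_nil2 n)"
  by (simp add: carrier_free_nil2)

lemma repr_Nil: "repr n [] = \<one>\<^bsub>free_nil2 n\<^esub>"
proof -
  interpret N: group "free_nil2 n" by (rule group_free_nil2)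
  have "repr n [] \<otimes>\<^bsub>free_nil2 n\<^esub> repr n [] = repr n []"
    by (simp add: repr_mult)
  then show ?thesis
    using N.l_cancel_one' by (metis repr_closed words_Nil)
qed

lemma repr_inverse_letter:
  assumes "i \<in> {1..n}"
  shows "repr n [(i, False)] = inv\<^bsub>free_nil2 n\<^esub> gen n i"
proof -
  interpret N: group "free_nil2 n" by (rule group_free_nil2)
  have "repr n ([(i, False)] @ [(i, True)]) = \<one>\<^bsub>free_nil2 n\<^esub>"
    unfolding repr_Nil[symmetric] by (simp add: repr_def reduce_def inv_letter_def)
  then have "repr n [(i, False)] \<otimes>\<^bsub>free_nil2 n\<^esub> gen n i = \<one>\<^bsub>free_nil2 n\<^esub>"
    using assms by (simp add: repr_mult)
  then show ?thesis
    using assms by (intro N.inv_equality[symmetric]) auto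
qed

lemma repr_eq_word_val:
  assumes "w \<in> words n"
  shows "repr n w = group.word_val (free_nil2 n) (gen n) w"
proof -
  interpret N: group "free_nil2 n" by (rule group_free_nil2)
  show ?thesis
    using assms
  proof (induction w)
    case (Cons a w)
    have "repr n (a # w) = repr n [a] \<otimes>\<^bsub>free_nil2 n\<^esub> repr n w"
      using Cons.prems by (simp add: repr_mult)
    moreover have "repr n [a] = N.letter_val (gen n) a"
      using Cons.prems by (cases a) (auto simp: N.letter_val_def repr_inverse_letter)
    ultimately show ?case
      using Cons by simp
  qed (simp add: repr_Nil)
qed

lemma gen_closed: "gen n \<in> {1..n} \<rightarrow> carrier (free_nil2 n)"
  by auto

lemma central_commutators_free_nil2: "group.central_commutators (free_nil2 n)"
proof -
  interpret F: group "free_group n" by (rule group_free_group)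
  interpret N: group "free_nil2 n" by (rule group_free_nil2)
  let ?q = "\<lambda>w. gamma3 (free_group n) #>\<^bsub>free_group n\<^esub> w"
  have hom: "?q \<in> hom (free_group n) (free_nil2 n)"
    unfolding free_nil2_def by (rule normal.r_coset_hom_Mod[OF F.gamma3_normal])
  interpret q: group_hom "free_group n" "free_nil2 n" ?q
    by unfold_locales (rule hom)
  have one: "?q w = \<one>\<^bsub>free_nil2 n\<^esub>" if "w \<in> gamma3 (free_group n)" for w
  proof -
    have sub: "subgroup (gamma3 (free_group n)) (free_group n)"
      using F.gamma3_normal by (rule normal_imp_subgroup)
    show ?thesis
      using F.coset_join2[OF subgroup.mem_carrier[OF sub that] sub that] by (simp add: free_nil2_def)
  qed
  have surj: "\<exists>w \<in> carrier (free_group n). x = ?q w" if "x \<in> carrier (free_nil2 n)" for x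
    using that by (auto simp: free_nil2_def carrier_FactGroup)
  show ?thesis
    unfolding N.central_commutators_def
  proof (intro ballI)
    fix x y z
    assume "x \<in> carrier (free_nil2 n)" "y \<in> carrier (free_nil2 n)" "z \<in> carrier (free_nil2 n)"
    then obtain u v w where uvw [simp]: "u \<in> carrier (free_group n)" "v \<in> carrier (free_group n)"
      "w \<in> carrier (free_group n)" and x: "x = ?q u" and y: "y = ?q v" and z: "z = ?q w"
      using surj by metis
    define c where "c = u \<otimes>\<^bsub>free_group n\<^esub> v \<otimes>\<^bsub>free_group n\<^esub> inv\<^bsub>free_group n\<^esub> u \<otimes>\<^bsub>free_group n\<^esub> inv\<^bsub>free_group n\<^esub> v"
    have c [simp]: "c \<in> carrier (free_group n)"
      by (simp add: c_def)
    have "c \<in> commutator_subgroup (free_group n) (carrier (free_group n)) (carrier (free_group n))"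
      unfolding commutator_subgroup_def c_def by (rule generate.incl) force
    then have "c \<otimes>\<^bsub>free_group n\<^esub> w \<otimes>\<^bsub>free_group n\<^esub> inv\<^bsub>free_group n\<^esub> c \<otimes>\<^bsub>free_group n\<^esub> inv\<^bsub>free_group n\<^esub> w
        \<in> gamma3 (free_group n)"
      unfolding gamma3_def commutator_subgroup_def[of _ "commutator_subgroup _ _ _"]
      by (intro generate.incl) force
    from one[OF this] have "?q c \<otimes>\<^bsub>free_nil2 n\<^esub> z \<otimes>\<^bsub>free_nil2 n\<^esub> inv\<^bsub>free_nil2 n\<^esub> ?q c \<otimes>\<^bsub>free_nil2 n\<^esub> inv\<^bsub>free_nil2 n\<^esub> z
        = \<one>\<^bsub>free_nil2 n\<^esub>"
      by (simp add: z)
    then have "?q c \<otimes>\<^bsub>free_nil2 n\<^esub> z = z \<otimes>\<^bsub>free_nil2 n\<^esub> ?q c"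
      by (intro N.commute_if_commutator_one) (simp_all add: z)
    moreover have "?q c = x \<otimes>\<^bsub>free_nil2 n\<^esub> y \<otimes>\<^bsub>free_nil2 n\<^esub> inv\<^bsub>free_nil2 n\<^esub> x \<otimes>\<^bsub>free_nil2 n\<^esub> inv\<^bsub>free_nil2 n\<^esub> y"
      by (simp add: c_def x y)
    ultimately show "x \<otimes>\<^bsub>free_nil2 n\<^esub> y \<otimes>\<^bsub>free_nil2 n\<^esub> inv\<^bsub>free_nil2 n\<^esub> x \<otimes>\<^bsub>free_nil2 n\<^esub> inv\<^bsub>free_nil2 n\<^esub> y \<otimes>\<^bsub>free_nil2 n\<^esub> z =
       z \<otimes>\<^bsub>free_nil2 n\<^esub> (x \<otimes>\<^bsub>free_nil2 n\<^esub> y \<otimes>\<^bsub>free_nil2 n\<^esub> inv\<^bsub>free_nil2 n\<^esub> x \<otimes>\<^bsub>free_nil2 n\<^esub> inv\<^bsub>free_nil2 n\<^esub> y)"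
      by simp
  qed
qed

text \<open>The map of the free group given by \<open>f\<close> kills \<open>\<gamma>\<^sub>3\<close> and therefore factors through the quotient. This is
  applied with \<open>G\<close> the free nilpotent group itself, to obtain endomorphisms, and with \<open>G\<close> the
  integers, to obtain the exponent sums.\<close>

lemma (in group) free_nil2_universal:
  assumes cc: central_commutators and f: "f \<in> {1..n} \<rightarrow> carrier G"
  obtains h where "h \<in> hom (free_nil2 n) G" "\<And>w. w \<in> words n \<Longrightarrow> h (repr n w) = word_val f w"
proof -
  interpret F: group "free_group n" by (rule group_free_group)
  interpret v: group_hom "free_group n" G "word_val f"
    by unfold_locales (rule word_val_hom_free_group[OF f])
  have *: "word_val f x = word_val f y"
    if "x \<in> carrier (free_group n)" "y \<in> carrier (free_group n)"
      "gamma3 (free_group n) #>\<^bsub>free_group n\<^esub> x = gamma3 (free_group n) #>\<^bsub>free_group n\<^esub> y" for x y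
  proof -
    have sub: "subgroup (gamma3 (free_group n)) (free_group n)"
      using F.gamma3_normal by (rule normal_imp_subgroup)
    have "x \<in> gamma3 (free_group n) #>\<^bsub>free_group n\<^esub> y"
      using F.rcos_self[OF that(1) sub] that(3) by simp
    then obtain g where g: "g \<in> gamma3 (free_group n)" "x = g \<otimes>\<^bsub>free_group n\<^esub> y"
      by (auto simp: r_coset_def)
    then show ?thesis
      using v.hom_gamma3[OF cc g(1)] that(2) subgroup.mem_carrier[OF sub g(1)] by simp
  qed
  obtain h where h: "h \<in> hom (free_nil2 n) G"
    "\<And>x. x \<in> carrier (free_group n) \<Longrightarrow> h (gamma3 (free_group n) #>\<^bsub>free_group n\<^esub> x) = word_val f x"
    unfolding free_nil2_def
    using FactGroup_universal[OF word_val_hom_free_group[OF f] F.gamma3_normal] * by metis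
  show thesis
  proof (rule that[OF h(1)])
    fix w assume "w \<in> words n"
    then show "h (repr n w) = word_val f w"
      using h(2)[of "reduce w"] f
      by (simp add: repr_def word_val_reduce free_group_def reduced_reduce reduce_words)
  qed
qed

section \<open>Palindromes in groups with central commutators\<close>

definition exponent :: "nat \<Rightarrow> word \<Rightarrow> int" where
  "exponent j w = (\<Sum>a\<leftarrow>w. if fst a = j then (if snd a then 1 else -1) else 0)"

lemma exponent_Nil [simp]: "exponent j [] = 0"
  and exponent_Cons: "exponent j (a # w) = (if fst a = j then (if snd a then 1 else -1) else 0) + exponent j w"
  and exponent_append [simp]: "exponent j (u @ v) = exponent j u + exponent j v"
  by (simp_all add: exponent_def)

lemma exponent_rev [simp]: "exponent j (rev w) = exponent j w"
  by (induction w) (simp_all add: exponent_Cons)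

text \<open>Without the letter inverse to \<open>a\<close>, all occurrences of the generator of \<open>a\<close> contribute with the same
  sign, so they cannot cancel; a vanishing exponent sum therefore forces that letter to occur.\<close>

lemma exponent_sign:
  "inv_letter a \<notin> set w \<Longrightarrow> (if snd a then exponent (fst a) w \<ge> 0 else exponent (fst a) w \<le> 0)"
  by (induction w) (auto simp: exponent_Cons inv_letter_def prod_eq_iff split: if_splits)

lemma inverse_letter_occurs:
  "exponent (fst a) (a # w) = 0 \<Longrightarrow> inv_letter a \<in> set w"
  using exponent_sign[of a w] by (auto simp: exponent_Cons split: if_splits)

lemma word_val_integer_group:
  assumes "w \<in> words n"
  shows "group.word_val integer_group f w = (\<Sum>i = 1..n. exponent i w * f i)"
proof -
  interpret Z: group integer_group by simp
  show ?thesis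
    using assms
  proof (induction w)
    case (Cons a w)
    have "(\<Sum>i = 1..n. exponent i (a # w) * f i) =
        (\<Sum>i = 1..n. (if fst a = i then (if snd a then f i else - f i) else 0) + exponent i w * f i)"
      by (intro sum.cong) (auto simp: exponent_Cons algebra_simps)
    also have "\<dots> = (if snd a then f (fst a) else - f (fst a)) + (\<Sum>i = 1..n. exponent i w * f i)"
      using Cons.prems by (simp add: sum.distrib)
    finally show ?case
      using Cons by (simp add: Z.letter_val_def)
  qed simp
qed

lemma fst_inv_letter [simp]: "fst (inv_letter a) = fst a"
  by (simp add: inv_letter_def)

text \<open>Passing from \<open>x y\<close> to \<open>y x\<close> on the left of \<open>g\<close> costs a central factor \<open>c\<close>; passing from \<open>y x\<close> to
  \<open>x y\<close> on the right costs its inverse, and the two cancel.\<close>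

lemma (in group) sandwich_commute:
  assumes cc: central_commutators and [simp]: "x \<in> carrier G" "y \<in> carrier G" "g \<in> carrier G"
  shows "x \<otimes> (y \<otimes> g \<otimes> y) \<otimes> x = y \<otimes> (x \<otimes> g \<otimes> x) \<otimes> y"
proof -
  define c where "c = x \<otimes> y \<otimes> inv x \<otimes> inv y"
  have [simp]: "c \<in> carrier G"
    by (simp add: c_def)
  have xy: "x \<otimes> y = c \<otimes> (y \<otimes> x)"
    by (simp add: c_def m_assoc)
  have "x \<otimes> (y \<otimes> g \<otimes> y) \<otimes> x = (x \<otimes> y) \<otimes> g \<otimes> (y \<otimes> x)"
    by (simp add: m_assoc)
  also have "\<dots> = c \<otimes> (y \<otimes> x \<otimes> g) \<otimes> (y \<otimes> x)"
    by (simp add: xy m_assoc)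
  also have "c \<otimes> (y \<otimes> x \<otimes> g) = (y \<otimes> x \<otimes> g) \<otimes> c"
    using cc by (simp add: central_commutators_def c_def)
  also have "(y \<otimes> x \<otimes> g) \<otimes> c \<otimes> (y \<otimes> x) = y \<otimes> x \<otimes> g \<otimes> (x \<otimes> y)"
    by (simp add: xy m_assoc)
  also have "\<dots> = y \<otimes> (x \<otimes> g \<otimes> x) \<otimes> y"
    by (simp add: m_assoc)
  finally show ?thesis .
qed

definition (in group) sandwich :: "(nat \<Rightarrow> 'a) \<Rightarrow> word \<Rightarrow> 'a \<Rightarrow> 'a" where
  "sandwich f w g = word_val f w \<otimes> g \<otimes> word_val f (rev w)"

context group
begin

context
  fixes f :: "nat \<Rightarrow> 'a" and n :: nat
  assumes f: "f \<in> {1..n} \<rightarrow> carrier G"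
begin

lemma sandwich_closed [simp]:
  "\<lbrakk>w \<in> words n; g \<in> carrier G\<rbrakk> \<Longrightarrow> sandwich f w g \<in> carrier G"
  using word_val_closed[OF f] by (simp add: sandwich_def)

lemma sandwich_Nil: "g \<in> carrier G \<Longrightarrow> sandwich f [] g = g"
  by (simp add: sandwich_def)

lemma sandwich_Cons:
  assumes "a # w \<in> words n" "g \<in> carrier G"
  shows "sandwich f (a # w) g = letter_val f a \<otimes> sandwich f w g \<otimes> letter_val f a"
  using assms word_val_closed[OF f] letter_val_closed[OF f]
  by (simp add: sandwich_def word_val_append[OF f] m_assoc)

lemma sandwich_append:
  assumes "u \<in> words n" "v \<in> words n" "g \<in> carrier G"
  shows "sandwich f (u @ v) g = sandwich f u (sandwich f v g)"
  using assms word_val_closed[OF f]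
  by (simp add: sandwich_def word_val_append[OF f] m_assoc)

text \<open>The outer letter \<open>a\<close> is moved inwards through \<open>u\<close> by commuting sandwich maps until it meets the
  sandwich map of its inverse.\<close>

lemma sandwich_cancel_pair:
  assumes cc: central_commutators and "a # u \<in> words n" "g \<in> carrier G"
  shows "sandwich f (a # u @ [inv_letter a]) g = sandwich f u g"
  using assms(2,3)
proof (induction u)
  case Nil
  then show ?case
    using letter_val_closed[OF f] letter_val_inv_letter[OF f]
    by (simp add: sandwich_Cons sandwich_Nil inv_letter_def m_assoc)
next
  case (Cons b u)
  let ?a = "letter_val f a" and ?b = "letter_val f b" and ?g = "sandwich f (u @ [inv_letter a]) g"
  have [simp]: "?a \<in> carrier G" "?b \<in> carrier G" "u @ [inv_letter a] \<in> words n"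
    using Cons.prems letter_val_closed[OF f] by (simp_all add: inv_letter_def)
  have "sandwich f (a # (b # u) @ [inv_letter a]) g = ?a \<otimes> (?b \<otimes> ?g \<otimes> ?b) \<otimes> ?a"
    using Cons.prems by (simp add: sandwich_Cons)
  also have "\<dots> = ?b \<otimes> (?a \<otimes> ?g \<otimes> ?a) \<otimes> ?b"
    using Cons.prems by (intro sandwich_commute[OF cc]) simp_all
  also have "?a \<otimes> ?g \<otimes> ?a = sandwich f u g"
    using Cons by (simp add: sandwich_Cons)
  also have "?b \<otimes> sandwich f u g \<otimes> ?b = sandwich f (b # u) g"
    using Cons.prems by (simp add: sandwich_Cons)
  finally show ?case .
qed

text \<open>The first letter of \<open>w\<close> is cancelled against an occurrence of its inverse, which the vanishing exponent
  sum provides; the remaining word is shorter and still has vanishing exponent sums.\<close>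

lemma sandwich_eq_if_exponents_zero:
  assumes cc: central_commutators
  shows "\<lbrakk>w \<in> words n; g \<in> carrier G; \<And>j. j \<in> {1..n} \<Longrightarrow> exponent j w = 0\<rbrakk> \<Longrightarrow> sandwich f w g = g"
proof (induction w rule: length_induct)
  case (1 w)
  show ?case
  proof (cases w)
    case Nil
    then show ?thesis using 1 by (simp add: sandwich_Nil)
  next
    case (Cons a v)
    then have "inv_letter a \<in> set v"
      using 1 by (intro inverse_letter_occurs) auto
    then obtain v1 v2 where v: "v = v1 @ inv_letter a # v2"
      by (auto dest: split_list)
    have w: "w = (a # v1 @ [inv_letter a]) @ v2"
      by (simp add: Cons v)
    have words: "a # v1 \<in> words n" "a # v1 @ [inv_letter a] \<in> words n" "v1 \<in> words n" "v2 \<in> words n"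
      using 1(2) unfolding w by auto
    have "exponent j (v1 @ v2) = 0" if "j \<in> {1..n}" for j
      using 1(4)[OF that] unfolding w by (auto simp: exponent_Cons inv_letter_def split: if_splits)
    then have "sandwich f (v1 @ v2) g = g"
      using 1 words by (intro 1(1)[rule_format]) (auto simp: w)
    then show ?thesis
      unfolding w using words 1(3)
      by (simp only: sandwich_append sandwich_closed sandwich_cancel_pair[OF cc])
  qed
qed

end

end

lemma palindrome_word_cases:
  "rev w = w \<Longrightarrow> \<exists>u. w = u @ rev u \<or> (\<exists>a. w = u @ a # rev u)"
proof (induction w rule: length_induct)
  case (1 w)
  show ?case
  proof (cases w)
    case w: (Cons a v)
    show ?thesis
    proof (cases v rule: rev_cases)
      case Nil
      then have "w = [] @ a # rev []"
        using w by simp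
      then show ?thesis by blast
    next
      case (snoc v' b)
      have "rev (a # v' @ [b]) = a # v' @ [b]"
        using 1(2) unfolding w snoc .
      moreover have "rev (a # v' @ [b]) = b # rev v' @ [a]"
        by simp
      ultimately have b: "b = a" and v': "rev v' = v'"
        by (metis list.inject append1_eq_conv)+
      have "length v' < length w"
        by (simp add: w snoc)
      then obtain u where "v' = u @ rev u \<or> (\<exists>c. v' = u @ c # rev u)"
        using 1(1) v' by blast
      then show ?thesis
      proof (elim disjE exE)
        assume "v' = u @ rev u"
        then have "w = (a # u) @ rev (a # u)"
          by (simp add: w snoc b)
        then show ?thesis by blast
      next
        fix c assume "v' = u @ c # rev u"
        then have "w = (a # u) @ c # rev (a # u)"
          by (simp add: w snoc b)
        then show ?thesis by blast
      qed
    qed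
  qed simp
qed

text \<open>All letters outside the middle come in mirror pairs, so only the generator in the middle can have an odd
  exponent sum.\<close>

lemma palindrome_odd_exponent_unique:
  assumes "rev w = w" "odd (exponent i w)" "odd (exponent j w)"
  shows "i = j"
proof -
  obtain u where "w = u @ rev u \<or> (\<exists>a. w = u @ a # rev u)"
    using palindrome_word_cases[OF assms(1)] by blast
  then show ?thesis
  proof (elim disjE exE)
    fix a assume w: "w = u @ a # rev u"
    have "fst a = k" if "odd (exponent k w)" for k
      using that unfolding w by (auto simp: exponent_Cons split: if_splits)
    then show ?thesis
      using assms(2,3) by metis
  qed (use assms(2) in auto)
qed

text \<open>By parity the middle letter is \<open>x\<^sub>i\<close> or its inverse. In the first case the left half has exponent sums
  zero. In the second case the inverse of \<open>x\<^sub>i\<close> is itself \<open>x\<^sub>i\<close> sandwiched between two copies of its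
  inverse, which reduces the claim to the first case.\<close>

lemma (in group) palindrome_word_val:
  assumes cc: central_commutators and f: "f \<in> {1..n} \<rightarrow> carrier G" and i: "i \<in> {1..n}"
    and w: "w \<in> words n" "rev w = w"
    and exps: "\<And>j. j \<in> {1..n} \<Longrightarrow> exponent j w = of_bool (j = i)"
  shows "word_val f w = f i"
proof -
  have fi [simp]: "f i \<in> carrier G"
    using f i by auto
  have "odd (exponent i w)"
    using exps[OF i] by simp
  then obtain u b where u: "w = u @ (i, b) # rev u"
  proof -
    obtain u where "w = u @ rev u \<or> (\<exists>a. w = u @ a # rev u)"
      using palindrome_word_cases[OF w(2)] by blast
    then show thesis
    proof (elim disjE exE)
      fix a assume a: "w = u @ a # rev u"
      have "fst a = i"
        using \<open>odd (exponent i w)\<close> unfolding a by (auto simp: exponent_Cons split: if_splits)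
      then show thesis
        using a that[of u "snd a"] by (metis prod.collapse)
    qed (use \<open>odd (exponent i w)\<close> in auto)
  qed
  then have words: "u \<in> words n"
    using w by simp
  have val: "word_val f w = sandwich f u (letter_val f (i, b))"
    using words i letter_val_closed[OF f] word_val_closed[OF f]
    by (simp add: u sandwich_def word_val_append[OF f] m_assoc)
  show ?thesis
  proof (cases b)
    case True
    have "exponent j u = 0" if "j \<in> {1..n}" for j
      using exps[OF that] True by (cases "i = j") (auto simp: u exponent_Cons)
    then have "sandwich f u (f i) = f i"
      using words by (intro sandwich_eq_if_exponents_zero[OF f cc]) simp_all
    then show ?thesis
      using val True by (simp add: letter_val_def)
  next
    case False
    have "sandwich f [(i, False)] (f i) = inv (f i)"
      using i by (simp add: sandwich_Cons[OF f] sandwich_Nil[OF f] letter_val_def)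
    then have eq: "word_val f w = sandwich f (u @ [(i, False)]) (f i)"
      using val False words i by (simp add: sandwich_append[OF f] letter_val_def)
    have "exponent j (u @ [(i, False)]) = 0" if "j \<in> {1..n}" for j
      using exps[OF that] False by (cases "i = j") (auto simp: u exponent_Cons)
    then have "sandwich f (u @ [(i, False)]) (f i) = f i"
      using words i by (intro sandwich_eq_if_exponents_zero[OF f cc]) simp_all
    with eq show ?thesis by simp
  qed
qed


section \<open>Homomorphisms on a basis and exponent sums\<close>

lemma (in group) word_val_cong:
  "\<lbrakk>\<And>i. i \<in> {1..n} \<Longrightarrow> f i = g i; w \<in> words n\<rbrakk> \<Longrightarrow> word_val f w = word_val g w"
  by (induction w) (auto simp: letter_val_def)

lemma hom_repr:
  assumes "group K" and h: "h \<in> hom (free_nil2 n) K" and w: "w \<in> words n"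
  shows "h (repr n w) = group.word_val K (h \<circ> gen n) w"
proof -
  interpret group_hom "free_nil2 n" K h
    using assms group_free_nil2 by (simp add: group_hom_def group_hom_axioms_def)
  show ?thesis
    using hom_word_val[OF gen_closed w] w by (simp add: repr_eq_word_val)
qed

lemma hom_eq_if_eq_on_basis:
  assumes K: "group K" and h: "h \<in> hom (free_nil2 n) K" "h' \<in> hom (free_nil2 n) K"
    and eq: "\<And>i. i \<in> {1..n} \<Longrightarrow> h (gen n i) = h' (gen n i)" and x: "x \<in> carrier (free_nil2 n)"
  shows "h x = h' x"
proof -
  obtain w where "w \<in> words n" "x = repr n w"
    using x by (auto simp: carrier_free_nil2)
  then show ?thesis
    using hom_repr[OF K h(1)] hom_repr[OF K h(2)] group.word_val_cong[OF K, of n "h \<circ> gen n" "h' \<circ> gen n"] eq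
    by simp
qed

lemma exponent_hom_exists:
  assumes j: "j \<in> {1..n}"
  shows "\<exists>e \<in> hom (free_nil2 n) integer_group. \<forall>w \<in> words n. e (repr n w) = exponent j w"
proof -
  interpret Z: group integer_group by simp
  have "Z.central_commutators"
    by (simp add: Z.central_commutators_def)
  then obtain e where e: "e \<in> hom (free_nil2 n) integer_group"
    "\<And>w. w \<in> words n \<Longrightarrow> e (repr n w) = Z.word_val (\<lambda>i. of_bool (i = j)) w"
    using Z.free_nil2_universal[of "\<lambda>i. of_bool (i = j)" n] by auto
  have "e (repr n w) = exponent j w" if "w \<in> words n" for w
  proof -
    have "(\<Sum>i = 1..n. exponent i w * of_bool (i = j)) = (\<Sum>i = 1..n. if i = j then exponent i w else 0)"
      by (intro sum.cong) auto
    then show ?thesis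
      using e(2)[OF that] that j by (simp add: word_val_integer_group)
  qed
  then show ?thesis
    using e(1) by blast
qed

text \<open>By \<open>hom_eq_if_eq_on_basis\<close> the conditions determine the chosen function on the carrier.\<close>

definition nil_exponent :: "nat \<Rightarrow> nat \<Rightarrow> word set \<Rightarrow> int" where
  "nil_exponent n j = (SOME e. e \<in> hom (free_nil2 n) integer_group \<and> (\<forall>w \<in> words n. e (repr n w) = exponent j w))"

lemma nil_exponent:
  assumes "j \<in> {1..n}"
  shows nil_exponent_hom: "nil_exponent n j \<in> hom (free_nil2 n) integer_group"
    and nil_exponent_repr: "w \<in> words n \<Longrightarrow> nil_exponent n j (repr n w) = exponent j w"
proof -
  have "\<exists>e. e \<in> hom (free_nil2 n) integer_group \<and> (\<forall>w \<in> words n. e (repr n w) = exponent j w)"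
    using exponent_hom_exists[OF assms] by blast
  from someI_ex[OF this] show "nil_exponent n j \<in> hom (free_nil2 n) integer_group"
    and "w \<in> words n \<Longrightarrow> nil_exponent n j (repr n w) = exponent j w"
    unfolding nil_exponent_def by blast+
qed

section \<open>Palindromic automorphisms given by their values on the basis\<close>

lemma carrier_AutoGroup [simp]: "carrier (AutoGroup G) = auto G"
  and one_AutoGroup: "\<one>\<^bsub>AutoGroup G\<^esub> = (\<lambda>x \<in> carrier G. x)"
  by (simp_all add: AutoGroup_def BijGroup_def)

lemma mult_AutoGroup:
  "\<lbrakk>\<phi> \<in> auto G; \<psi> \<in> auto G\<rbrakk> \<Longrightarrow> \<phi> \<otimes>\<^bsub>AutoGroup G\<^esub> \<psi> = compose (carrier G) \<phi> \<psi>"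
  by (simp add: AutoGroup_def BijGroup_def auto_def)

lemma auto_hom: "\<phi> \<in> auto G \<Longrightarrow> \<phi> \<in> hom G G"
  by (simp add: auto_def)

lemma auto_surj: "\<lbrakk>\<phi> \<in> auto G; y \<in> carrier G\<rbrakk> \<Longrightarrow> \<exists>x \<in> carrier G. y = \<phi> x"
  unfolding auto_def Bij_def bij_betw_def by blast

lemma auto_extensional: "\<phi> \<in> auto G \<Longrightarrow> \<phi> \<in> extensional (carrier G)"
  by (simp add: auto_def Bij_def)

lemma mult_AutoGroup_apply:
  "\<lbrakk>\<phi> \<in> auto G; \<psi> \<in> auto G; x \<in> carrier G\<rbrakk> \<Longrightarrow> (\<phi> \<otimes>\<^bsub>AutoGroup G\<^esub> \<psi>) x = \<phi> (\<psi> x)"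
  by (simp add: mult_AutoGroup compose_def)

lemma group_AutoGroup_nil2: "group (AutoGroup (free_nil2 n))"
  by (rule group.AutoGroup[OF group_free_nil2])

lemma auto_eqI:
  assumes "\<phi> \<in> auto (free_nil2 n)" "\<psi> \<in> auto (free_nil2 n)" "\<And>k. k \<in> {1..n} \<Longrightarrow> \<phi> (gen n k) = \<psi> (gen n k)"
  shows "\<phi> = \<psi>"
  by (rule extensionalityI[OF auto_extensional[OF assms(1)] auto_extensional[OF assms(2)]])
    (rule hom_eq_if_eq_on_basis[OF group_free_nil2 auto_hom[OF assms(1)] auto_hom[OF assms(2)] assms(3)])

lemma basis_aut_eq:
  assumes "\<phi> \<in> auto (free_nil2 n)" "\<And>k. k \<in> {1..n} \<Longrightarrow> \<phi> (gen n k) = y k"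
  shows "basis_aut n y = \<phi>"
  unfolding basis_aut_def
proof (rule the_equality)
  fix \<psi> assume "\<psi> \<in> auto (free_nil2 n) \<and> (\<forall>k \<in> {1..n}. \<psi> (gen n k) = y k)"
  then show "\<psi> = \<phi>"
    using assms auto_eqI[of \<psi> n \<phi>] by metis
qed (use assms in blast)

lemma endomorphism_exists:
  assumes y: "y \<in> {1..n} \<rightarrow> carrier (free_nil2 n)"
  shows "\<exists>h \<in> hom (free_nil2 n) (free_nil2 n).
    h \<in> extensional (carrier (free_nil2 n)) \<and> (\<forall>k \<in> {1..n}. h (gen n k) = y k)"
proof -
  interpret N: group "free_nil2 n" by (rule group_free_nil2)
  obtain h where h: "h \<in> hom (free_nil2 n) (free_nil2 n)"
    "\<And>w. w \<in> words n \<Longrightarrow> h (repr n w) = N.word_val y w"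
    using N.free_nil2_universal[OF central_commutators_free_nil2 y] by blast
  let ?h = "restrict h (carrier (free_nil2 n))"
  have "?h \<in> hom (free_nil2 n) (free_nil2 n)"
    using h(1) by (auto simp: hom_def Pi_iff)
  moreover have "?h (gen n k) = y k" if "k \<in> {1..n}" for k
    using h(2)[of "[(k, True)]"] y that by (auto simp: N.letter_val_def Pi_iff)
  ultimately show ?thesis
    using restrict_extensional by blast
qed

text \<open>The substitutions \<open>y\<close> and \<open>z\<close> of the basis are compared through every homomorphism \<open>\<phi>\<close> that realises
  \<open>y\<close>. So a proof only has to evaluate a homomorphism on an explicit product of basis elements.\<close>

definition undoes :: "nat \<Rightarrow> (nat \<Rightarrow> word set) \<Rightarrow> (nat \<Rightarrow> word set) \<Rightarrow> bool" where
  "undoes n y z \<longleftrightarrow> (\<forall>\<phi> \<in> hom (free_nil2 n) (free_nil2 n).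
     (\<forall>i \<in> {1..n}. \<phi> (gen n i) = y i) \<longrightarrow> (\<forall>k \<in> {1..n}. \<phi> (z k) = gen n k))"

lemma undoesI:
  assumes "\<And>\<phi> k. \<lbrakk>group_hom (free_nil2 n) (free_nil2 n) \<phi>; \<And>i. i \<in> {1..n} \<Longrightarrow> \<phi> (gen n i) = y i; k \<in> {1..n}\<rbrakk>
    \<Longrightarrow> \<phi> (z k) = gen n k"
  shows "undoes n y z"
  unfolding undoes_def
proof (intro ballI impI)
  fix \<phi> k
  assume \<phi>: "\<phi> \<in> hom (free_nil2 n) (free_nil2 n)" and "\<forall>i \<in> {1..n}. \<phi> (gen n i) = y i" "k \<in> {1..n}"
  moreover have "group_hom (free_nil2 n) (free_nil2 n) \<phi>"
    using \<phi> group_free_nil2 by (simp add: group_hom_def group_hom_axioms_def)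
  ultimately show "\<phi> (z k) = gen n k"
    by (intro assms) simp_all
qed

lemma basis_aut_inverse:
  assumes y: "y \<in> {1..n} \<rightarrow> carrier (free_nil2 n)" and z: "z \<in> {1..n} \<rightarrow> carrier (free_nil2 n)"
    and yz: "undoes n y z" and zy: "undoes n z y"
  shows "basis_aut n y \<in> auto (free_nil2 n)" "basis_aut n z \<in> auto (free_nil2 n)"
    "\<And>k. k \<in> {1..n} \<Longrightarrow> basis_aut n y (gen n k) = y k"
    "\<And>k. k \<in> {1..n} \<Longrightarrow> basis_aut n z (gen n k) = z k"
    "inv\<^bsub>AutoGroup (free_nil2 n)\<^esub> (basis_aut n y) = basis_aut n z"
proof -
  interpret AG: group "AutoGroup (free_nil2 n)" by (rule group_AutoGroup_nil2)
  obtain h where h: "h \<in> hom (free_nil2 n) (free_nil2 n)" "h \<in> extensional (carrier (free_nil2 n))"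
    "\<And>k. k \<in> {1..n} \<Longrightarrow> h (gen n k) = y k"
    using endomorphism_exists[OF y] by blast
  obtain h' where h': "h' \<in> hom (free_nil2 n) (free_nil2 n)" "h' \<in> extensional (carrier (free_nil2 n))"
    "\<And>k. k \<in> {1..n} \<Longrightarrow> h' (gen n k) = z k"
    using endomorphism_exists[OF z] by blast
  have undo: "h (z k) = gen n k" "h' (y k) = gen n k" if "k \<in> {1..n}" for k
    using yz[unfolded undoes_def, rule_format, OF h(1) h(3) that]
      zy[unfolded undoes_def, rule_format, OF h'(1) h'(3) that] by simp_all
  have id: "id \<in> hom (free_nil2 n) (free_nil2 n)"
    by (auto simp: hom_def)
  have hh': "h (h' x) = x" if "x \<in> carrier (free_nil2 n)" for x
    using hom_eq_if_eq_on_basis[OF group_free_nil2 hom_compose[OF h'(1) h(1)] id _ that] h' undo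
    by simp
  have h'h: "h' (h x) = x" if "x \<in> carrier (free_nil2 n)" for x
    using hom_eq_if_eq_on_basis[OF group_free_nil2 hom_compose[OF h(1) h'(1)] id _ that] h undo
    by simp
  have closed: "h x \<in> carrier (free_nil2 n)" "h' x \<in> carrier (free_nil2 n)" if "x \<in> carrier (free_nil2 n)" for x
    using that h(1) h'(1) by (auto simp: hom_def)
  have "bij_betw h (carrier (free_nil2 n)) (carrier (free_nil2 n))"
    "bij_betw h' (carrier (free_nil2 n)) (carrier (free_nil2 n))"
    using hh' h'h closed
    by (auto intro: bij_betw_byWitness[of _ h' h] bij_betw_byWitness[of _ h h'])
  then have auto: "h \<in> auto (free_nil2 n)" "h' \<in> auto (free_nil2 n)"
    using h h' by (simp_all add: auto_def Bij_def)
  have eq: "basis_aut n y = h" "basis_aut n z = h'"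
    using basis_aut_eq[OF auto(1) h(3)] basis_aut_eq[OF auto(2) h'(3)] by simp_all
  show "basis_aut n y \<in> auto (free_nil2 n)" "basis_aut n z \<in> auto (free_nil2 n)"
    "\<And>k. k \<in> {1..n} \<Longrightarrow> basis_aut n y (gen n k) = y k"
    "\<And>k. k \<in> {1..n} \<Longrightarrow> basis_aut n z (gen n k) = z k"
    using eq auto h(3) h'(3) by simp_all
  have "h' \<otimes>\<^bsub>AutoGroup (free_nil2 n)\<^esub> h = \<one>\<^bsub>AutoGroup (free_nil2 n)\<^esub>"
    using auto h'h by (auto simp: mult_AutoGroup one_AutoGroup compose_def intro: restrict_ext)
  then show "inv\<^bsub>AutoGroup (free_nil2 n)\<^esub> (basis_aut n y) = basis_aut n z"
    unfolding eq using auto by (intro AG.inv_equality) auto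
qed

text \<open>For a palindromic word, inverting each letter in place gives the same word as inverting and reversing.
  So the inverse of a palindrome is again represented by a palindromic word.\<close>

lemma repr_map_inv_letter:
  assumes w: "w \<in> words n" "rev w = w"
  shows "map inv_letter w \<in> words n" "repr n (map inv_letter w) = inv\<^bsub>free_nil2 n\<^esub> repr n w"
proof -
  interpret N: group "free_nil2 n" by (rule group_free_nil2)
  show words: "map inv_letter w \<in> words n"
    using w(1) by (induction w) simp_all
  have "rev (map inv_letter w) = map inv_letter w"
    using w(2) by (metis rev_map)
  then have "reduce (map inv_letter w @ w) = []"
    using reduce_inverse[of w] by simp
  then have "repr n (map inv_letter w) \<otimes>\<^bsub>free_nil2 n\<^esub> repr n w = \<one>\<^bsub>free_nil2 n\<^esub>"
    using words w by (simp add: repr_mult flip: repr_Nil) (simp add: repr_def reduce_def)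
  then show "repr n (map inv_letter w) = inv\<^bsub>free_nil2 n\<^esub> repr n w"
    using words w by (intro N.inv_equality[symmetric]) simp_all
qed

text \<open>Substituting palindromic words for the letters of a palindromic word gives a palindromic word.\<close>

lemma palindrome_hom_image:
  assumes \<phi>: "\<phi> \<in> hom (free_nil2 n) (free_nil2 n)"
    and gens: "\<And>i. i \<in> {1..n} \<Longrightarrow> palindrome n (\<phi> (gen n i))" and x: "palindrome n x"
  shows "palindrome n (\<phi> x)"
proof -
  interpret N: group "free_nil2 n" by (rule group_free_nil2)
  interpret \<phi>: group_hom "free_nil2 n" "free_nil2 n" \<phi>
    by unfold_locales (rule \<phi>)
  have "\<forall>i \<in> {1..n}. \<exists>w. w \<in> words n \<and> rev w = w \<and> \<phi> (gen n i) = repr n w"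
    using gens unfolding palindrome_def by blast
  then obtain W where W: "\<And>i. i \<in> {1..n} \<Longrightarrow> W i \<in> words n \<and> rev (W i) = W i \<and> \<phi> (gen n i) = repr n (W i)"
    by metis
  define S where "S a = (if snd a then W (fst a) else map inv_letter (W (fst a)))" for a
  have S: "S a \<in> words n" "rev (S a) = S a" "\<phi> (repr n [a]) = repr n (S a)" if "fst a \<in> {1..n}" for a
    using W[OF that] repr_map_inv_letter[of "W (fst a)" n] that
    by (cases a; auto simp: S_def rev_map repr_inverse_letter)+
  obtain w where w: "w \<in> words n" "rev w = w" "x = repr n w"
    using x by (auto simp: palindrome_def)
  have "concat (map S v) \<in> words n \<and> rev (concat (map S v)) = concat (map S (rev v))
      \<and> \<phi> (repr n v) = repr n (concat (map S v))" if "v \<in> words n" for v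
    using that
  proof (induction v)
    case Nil
    then show ?case
      by (simp add: repr_Nil)
  next
    case (Cons a v)
    have "repr n (a # v) = repr n [a] \<otimes>\<^bsub>free_nil2 n\<^esub> repr n v"
      using Cons.prems by (simp add: repr_mult)
    then have "\<phi> (repr n (a # v)) = repr n (S a) \<otimes>\<^bsub>free_nil2 n\<^esub> repr n (concat (map S v))"
      using Cons S[of a] by simp
    then show ?case
      using Cons S[of a] by (simp add: repr_mult)
  qed
  from this[OF w(1)] show ?thesis
    unfolding palindrome_def w(3) using w(2) by metis
qed

lemma palindromic_auts_mult:
  assumes "\<phi> \<in> palindromic_auts n" "\<psi> \<in> palindromic_auts n"
  shows "\<phi> \<otimes>\<^bsub>AutoGroup (free_nil2 n)\<^esub> \<psi> \<in> palindromic_auts n"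
proof -
  interpret AG: group "AutoGroup (free_nil2 n)" by (rule group_AutoGroup_nil2)
  have auto: "\<phi> \<in> auto (free_nil2 n)" "\<psi> \<in> auto (free_nil2 n)"
    using assms by (auto simp: palindromic_auts_def)
  then have "\<phi> \<otimes>\<^bsub>AutoGroup (free_nil2 n)\<^esub> \<psi> \<in> auto (free_nil2 n)"
    using AG.m_closed by simp
  moreover have "palindrome n (\<phi> (\<psi> (gen n i)))" if "i \<in> {1..n}" for i
  proof (rule palindrome_hom_image[OF auto_hom[OF auto(1)]])
    show "palindrome n (\<phi> (gen n j))" if "j \<in> {1..n}" for j
      using assms(1) that by (simp add: palindromic_auts_def)
    show "palindrome n (\<psi> (gen n i))"
      using assms(2) that by (simp add: palindromic_auts_def)
  qed
  ultimately show ?thesis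
    using auto by (simp add: palindromic_auts_def mult_AutoGroup_apply)
qed

lemma palindrome_gen: "i \<in> {1..n} \<Longrightarrow> palindrome n (gen n i)"
  unfolding palindrome_def by (intro bexI[of _ "[(i, True)]"]) auto

lemma palindrome_inv_gen: "i \<in> {1..n} \<Longrightarrow> palindrome n (inv\<^bsub>free_nil2 n\<^esub> gen n i)"
  unfolding palindrome_def by (intro bexI[of _ "[(i, False)]"]) (auto simp: repr_inverse_letter)

lemma palindrome_sandwich:
  assumes "i \<in> {1..n}" "j \<in> {1..n}"
  shows "palindrome n (gen n j \<otimes>\<^bsub>free_nil2 n\<^esub> gen n i \<otimes>\<^bsub>free_nil2 n\<^esub> gen n j)"
    and "palindrome n (inv\<^bsub>free_nil2 n\<^esub> gen n j \<otimes>\<^bsub>free_nil2 n\<^esub> gen n i \<otimes>\<^bsub>free_nil2 n\<^esub> inv\<^bsub>free_nil2 n\<^esub> gen n j)"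
proof -
  show "palindrome n (gen n j \<otimes>\<^bsub>free_nil2 n\<^esub> gen n i \<otimes>\<^bsub>free_nil2 n\<^esub> gen n j)"
    unfolding palindrome_def using assms
    by (intro bexI[of _ "[(j, True), (i, True), (j, True)]"]) (simp_all add: repr_mult)
  have "repr n [(j, False)] \<otimes>\<^bsub>free_nil2 n\<^esub> gen n i \<otimes>\<^bsub>free_nil2 n\<^esub> repr n [(j, False)]
      = repr n [(j, False), (i, True), (j, False)]"
    using assms by (simp add: repr_mult)
  then show "palindrome n (inv\<^bsub>free_nil2 n\<^esub> gen n j \<otimes>\<^bsub>free_nil2 n\<^esub> gen n i \<otimes>\<^bsub>free_nil2 n\<^esub> inv\<^bsub>free_nil2 n\<^esub> gen n j)"
    unfolding palindrome_def repr_inverse_letter[OF assms(2)] using assms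
    by (intro bexI[of _ "[(j, False), (i, True), (j, False)]"]) simp_all
qed

lemma basis_aut_palindromic:
  assumes "basis_aut n y \<in> auto (free_nil2 n)" "\<And>k. k \<in> {1..n} \<Longrightarrow> basis_aut n y (gen n k) = y k"
    "\<And>k. k \<in> {1..n} \<Longrightarrow> palindrome n (y k)"
  shows "basis_aut n y \<in> palindromic_auts n"
  using assms by (simp add: palindromic_auts_def)

lemma t_aut:
  assumes i: "i \<in> {1..n}"
  shows t_aut_palindromic: "t_aut n i \<in> palindromic_auts n"
    and inv_t_aut: "inv\<^bsub>AutoGroup (free_nil2 n)\<^esub> (t_aut n i) \<in> palindromic_auts n"
    and t_aut_gen: "\<And>k. k \<in> {1..n} \<Longrightarrow> t_aut n i (gen n k) = (if k = i then inv\<^bsub>free_nil2 n\<^esub> gen n i else gen n k)"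
proof -
  interpret N: group "free_nil2 n" by (rule group_free_nil2)
  let ?y = "(gen n)(i := inv\<^bsub>free_nil2 n\<^esub> gen n i)"
  have y: "?y \<in> {1..n} \<rightarrow> carrier (free_nil2 n)"
    using i by auto
  have yy: "undoes n ?y ?y"
  proof (rule undoesI)
    fix \<phi> k
    assume "group_hom (free_nil2 n) (free_nil2 n) \<phi>" and eq: "\<And>k. k \<in> {1..n} \<Longrightarrow> \<phi> (gen n k) = ?y k"
      and k: "k \<in> {1..n}"
    then interpret \<phi>: group_hom "free_nil2 n" "free_nil2 n" \<phi> by simp
    show "\<phi> (?y k) = gen n k"
      using eq[of i] eq[of k] i k by auto
  qed
  note inverse = basis_aut_inverse[OF y y yy yy]
  have pal: "palindrome n (?y k)" if "k \<in> {1..n}" for k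
    using that i by (simp add: palindrome_gen palindrome_inv_gen)
  show "t_aut n i \<in> palindromic_auts n"
    unfolding t_aut_def using inverse(1,3) pal by (rule basis_aut_palindromic)
  then show "inv\<^bsub>AutoGroup (free_nil2 n)\<^esub> (t_aut n i) \<in> palindromic_auts n"
    unfolding t_aut_def inverse(5) .
  show "t_aut n i (gen n k) = (if k = i then inv\<^bsub>free_nil2 n\<^esub> gen n i else gen n k)" if "k \<in> {1..n}" for k
    unfolding t_aut_def using inverse(3)[OF that] by simp
qed

lemma alpha_aut:
  assumes l: "l \<in> {1..<n}"
  shows alpha_aut_palindromic: "alpha_aut n l \<in> palindromic_auts n"
    and inv_alpha_aut: "inv\<^bsub>AutoGroup (free_nil2 n)\<^esub> (alpha_aut n l) \<in> palindromic_auts n"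
    and alpha_aut_gen: "\<And>k. k \<in> {1..n} \<Longrightarrow> alpha_aut n l (gen n k) =
      (if k = l then gen n (l + 1) else if k = l + 1 then gen n l else gen n k)"
proof -
  let ?y = "(gen n)(l := gen n (l + 1), l + 1 := gen n l)"
  have y: "?y \<in> {1..n} \<rightarrow> carrier (free_nil2 n)"
    using l by auto
  have yy: "undoes n ?y ?y"
  proof (rule undoesI)
    fix \<phi> k
    assume eq: "\<And>k. k \<in> {1..n} \<Longrightarrow> \<phi> (gen n k) = ?y k" and k: "k \<in> {1..n}"
    show "\<phi> (?y k) = gen n k"
      using eq[of l] eq[of "l + 1"] eq[of k] l k by auto
  qed
  note inverse = basis_aut_inverse[OF y y yy yy]
  have pal: "palindrome n (?y k)" if "k \<in> {1..n}" for k
    using that l by (simp add: palindrome_gen)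
  show "alpha_aut n l \<in> palindromic_auts n"
    unfolding alpha_aut_def using inverse(1,3) pal by (rule basis_aut_palindromic)
  then show "inv\<^bsub>AutoGroup (free_nil2 n)\<^esub> (alpha_aut n l) \<in> palindromic_auts n"
    unfolding alpha_aut_def inverse(5) .
  show "alpha_aut n l (gen n k) = (if k = l then gen n (l + 1) else if k = l + 1 then gen n l else gen n k)"
    if "k \<in> {1..n}" for k
    unfolding alpha_aut_def using inverse(3)[OF that] by simp
qed

lemma mu_aut:
  assumes ij: "i \<in> {1..n}" "j \<in> {1..n}" "i \<noteq> j"
  shows mu_aut_palindromic: "mu_aut n i j \<in> palindromic_auts n"
    and inv_mu_aut: "inv\<^bsub>AutoGroup (free_nil2 n)\<^esub> (mu_aut n i j) \<in> palindromic_auts n"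
    and mu_aut_gen: "\<And>k. k \<in> {1..n} \<Longrightarrow> mu_aut n i j (gen n k) =
      (if k = i then gen n j \<otimes>\<^bsub>free_nil2 n\<^esub> gen n i \<otimes>\<^bsub>free_nil2 n\<^esub> gen n j else gen n k)"
proof -
  interpret N: group "free_nil2 n" by (rule group_free_nil2)
  let ?y = "(gen n)(i := gen n j \<otimes>\<^bsub>free_nil2 n\<^esub> gen n i \<otimes>\<^bsub>free_nil2 n\<^esub> gen n j)"
  let ?z = "(gen n)(i := inv\<^bsub>free_nil2 n\<^esub> gen n j \<otimes>\<^bsub>free_nil2 n\<^esub> gen n i \<otimes>\<^bsub>free_nil2 n\<^esub> inv\<^bsub>free_nil2 n\<^esub> gen n j)"
  have y: "?y \<in> {1..n} \<rightarrow> carrier (free_nil2 n)" and z: "?z \<in> {1..n} \<rightarrow> carrier (free_nil2 n)"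
    using ij by auto
  have yz: "undoes n ?y ?z"
  proof (rule undoesI)
    fix \<phi> k
    assume "group_hom (free_nil2 n) (free_nil2 n) \<phi>" and eq: "\<And>k. k \<in> {1..n} \<Longrightarrow> \<phi> (gen n k) = ?y k"
      and k: "k \<in> {1..n}"
    then interpret \<phi>: group_hom "free_nil2 n" "free_nil2 n" \<phi> by simp
    show "\<phi> (?z k) = gen n k"
      using eq[of i] eq[of j] eq[of k] ij k by (auto simp: N.m_assoc)
  qed
  have zy: "undoes n ?z ?y"
  proof (rule undoesI)
    fix \<phi> k
    assume "group_hom (free_nil2 n) (free_nil2 n) \<phi>" and eq: "\<And>k. k \<in> {1..n} \<Longrightarrow> \<phi> (gen n k) = ?z k"
      and k: "k \<in> {1..n}"
    then interpret \<phi>: group_hom "free_nil2 n" "free_nil2 n" \<phi> by simp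
    show "\<phi> (?y k) = gen n k"
      using eq[of i] eq[of j] eq[of k] ij k by (auto simp: N.m_assoc)
  qed
  note inverse = basis_aut_inverse[OF y z yz zy]
  have pal: "palindrome n (?y k)" "palindrome n (?z k)" if "k \<in> {1..n}" for k
    using that ij by (simp_all add: palindrome_gen palindrome_sandwich)
  show "mu_aut n i j \<in> palindromic_auts n"
    unfolding mu_aut_def using inverse(1,3) pal(1) by (rule basis_aut_palindromic)
  show "inv\<^bsub>AutoGroup (free_nil2 n)\<^esub> (mu_aut n i j) \<in> palindromic_auts n"
    unfolding mu_aut_def inverse(5) using inverse(2,4) pal(2) by (rule basis_aut_palindromic)
  show "mu_aut n i j (gen n k) =
      (if k = i then gen n j \<otimes>\<^bsub>free_nil2 n\<^esub> gen n i \<otimes>\<^bsub>free_nil2 n\<^esub> gen n j else gen n k)" if "k \<in> {1..n}" for k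
    unfolding mu_aut_def using inverse(3)[OF that] by simp
qed


section \<open>Row reduction by even row operations\<close>

text \<open>The set \<open>M\<close> will consist of the matrices of all \<open>\<phi> \<circ> h\<close> with \<open>\<phi>\<close> a fixed palindromic automorphism and
  \<open>h\<close> a product of elementary ones. Invertibility is expressed by \<open>rows_span\<close>, which follows from
  surjectivity and serves directly in place of a determinant. Matrices are functions on all
  pairs of naturals and stand for their blocks with indices in \<open>{1..n}\<close>.\<close>

locale row_stable =
  fixes n :: nat and M :: "(nat \<Rightarrow> nat \<Rightarrow> int) set"
  assumes add_row: "\<lbrakk>A \<in> M; i \<in> {1..n}; j \<in> {1..n}; i \<noteq> j\<rbrakk> \<Longrightarrow> A(i := \<lambda>c. A i c + 2 * A j c) \<in> M"
    and negate_row: "\<lbrakk>A \<in> M; i \<in> {1..n}\<rbrakk> \<Longrightarrow> A(i := \<lambda>c. - A i c) \<in> M"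
    and swap_rows: "\<lbrakk>A \<in> M; l \<in> {1..<n}\<rbrakk> \<Longrightarrow> A(l := A (l + 1), l + 1 := A l) \<in> M"
    and row_odd_unique: "\<lbrakk>A \<in> M; i \<in> {1..n}; j \<in> {1..n}; j' \<in> {1..n}; odd (A i j); odd (A i j')\<rbrakk> \<Longrightarrow> j = j'"
    and rows_span: "\<lbrakk>A \<in> M; j \<in> {1..n}\<rbrakk> \<Longrightarrow>
      \<exists>c. \<forall>j' \<in> {1..n}. (\<Sum>i = 1..n. c i * A i j') = of_bool (j' = j)"
begin

lemma subtract_row:
  assumes "A \<in> M" "i \<in> {1..n}" "j \<in> {1..n}" "i \<noteq> j"
  shows "A(i := \<lambda>c. A i c - 2 * A j c) \<in> M"
proof -
  let ?B = "A(j := \<lambda>c. - A j c)"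
  let ?C = "?B(i := \<lambda>c. ?B i c + 2 * ?B j c)"
  have "?C(j := \<lambda>c. - ?C j c) \<in> M"
    by (intro negate_row add_row assms)
  moreover have "?C(j := \<lambda>c. - ?C j c) = A(i := \<lambda>c. A i c - 2 * A j c)"
    using assms(4) by (auto simp: fun_eq_iff)
  ultimately show ?thesis by simp
qed

text \<open>Modulo 2 the matrix is a permutation matrix: as the rows span, every column has an odd entry; choosing one
  for each column gives an injective, hence bijective, map from columns to rows.\<close>

lemma column_odd_unique:
  assumes A: "A \<in> M" and "i \<in> {1..n}" "i' \<in> {1..n}" "j \<in> {1..n}" "odd (A i j)" "odd (A i' j)"
  shows "i = i'"
proof -
  have "\<exists>r \<in> {1..n}. odd (A r q)" if q: "q \<in> {1..n}" for q
  proof (rule ccontr)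
    assume even: "\<not> (\<exists>r \<in> {1..n}. odd (A r q))"
    obtain c where "\<forall>q' \<in> {1..n}. (\<Sum>r = 1..n. c r * A r q') = of_bool (q' = q)"
      using rows_span[OF A q] by blast
    then have "(\<Sum>r = 1..n. c r * A r q) = 1"
      using q by simp
    moreover have "even (\<Sum>r = 1..n. c r * A r q)"
      using even by (intro dvd_sum) auto
    ultimately show False by simp
  qed
  then obtain r where r: "\<And>q. q \<in> {1..n} \<Longrightarrow> r q \<in> {1..n} \<and> odd (A (r q) q)"
    by metis
  have "inj_on r {1..n}"
    using r row_odd_unique[OF A] by (metis inj_onI)
  then have "r ` {1..n} = {1..n}"
    using r by (intro endo_inj_surj) auto
  then obtain q q' where q: "q \<in> {1..n}" "i = r q" "q' \<in> {1..n}" "i' = r q'"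
    using assms by (metis imageE)
  then have "q = j" "q' = j"
    using r row_odd_unique[OF A] assms by metis+
  then show ?thesis using q by simp
qed

definition identity_columns :: "nat \<Rightarrow> (nat \<Rightarrow> nat \<Rightarrow> int) \<Rightarrow> bool" where
  "identity_columns k A \<longleftrightarrow> (\<forall>i \<in> {1..n}. \<forall>j \<in> {1..k}. A i j = of_bool (i = j))"

lemma identity_columns_Suc:
  "identity_columns (k + 1) A \<longleftrightarrow>
    identity_columns k A \<and> (\<forall>i \<in> {1..n}. A i (k + 1) = of_bool (i = k + 1))"
  by (auto simp: identity_columns_def atLeastAtMostSuc_conv)

lemma move_pivot:
  assumes "k + 1 \<le> p" "p \<le> n" "A \<in> M" "identity_columns k A"
    and "\<forall>i \<in> {1..n}. A i (k + 1) = s * of_bool (i = p)"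
  shows "\<exists>B \<in> M. identity_columns k B \<and> (\<forall>i \<in> {1..n}. B i (k + 1) = s * of_bool (i = k + 1))"
  using assms
proof (induction p arbitrary: A rule: nat_induct_at_least)
  case base
  then show ?case by blast
next
  case (Suc p)
  define B where "B = A(p := A (p + 1), p + 1 := A p)"
  have "B \<in> M"
    unfolding B_def using Suc.prems Suc.hyps by (intro swap_rows) auto
  moreover have "identity_columns k B"
    using Suc.prems Suc.hyps by (auto simp: identity_columns_def B_def)
  moreover have "\<forall>i \<in> {1..n}. B i (k + 1) = s * of_bool (i = p)"
    using Suc.prems Suc.hyps by (auto simp: B_def)
  ultimately show ?case
    using Suc.IH[of B] Suc.prems by (meson Suc_leD)
qed

text \<open>Euclid's algorithm with even quotients, run on column \<open>k + 1\<close> by minimising the sum of the absolute values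
  of its entries. Only rows below the first \<open>k\<close> are added to other rows; these vanish in the
  first \<open>k\<close> columns, so the columns that are already reduced stay intact.\<close>

lemma clear_column:
  assumes k: "k < n" and ex: "\<exists>A \<in> M. identity_columns k A"
  shows "\<exists>A \<in> M. identity_columns k A \<and>
    (\<exists>p \<in> {k<..n}. \<bar>A p (k + 1)\<bar> = 1 \<and> (\<forall>i \<in> {1..n}. i \<noteq> p \<longrightarrow> A i (k + 1) = 0))"
proof -
  let ?m = "k + 1"
  let ?size = "\<lambda>A. \<Sum>i = 1..n. nat \<bar>A i ?m\<bar>"
  obtain A where A: "A \<in> M" "identity_columns k A"
    and least: "\<And>B. \<lbrakk>B \<in> M; identity_columns k B\<rbrakk> \<Longrightarrow> ?size A \<le> ?size B"
    using ex ex_has_least_nat[of "\<lambda>A. A \<in> M \<and> identity_columns k A" _ ?size] by blast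
  \<comment> \<open>Otherwise adding or subtracting twice row \<open>j\<close> makes the entry in row \<open>i\<close> smaller, because
    \<open>\<bar>a - 2 b\<bar> < \<bar>a\<bar>\<close> whenever \<open>0 < b < a\<close>.\<close>
  have minimal: "\<bar>A i ?m\<bar> \<le> \<bar>A j ?m\<bar>"
    if ij: "i \<in> {1..n}" "j \<in> {1..n}" "i \<noteq> j" "k < j" "A j ?m \<noteq> 0" for i j
  proof (rule ccontr)
    assume gt: "\<not> \<bar>A i ?m\<bar> \<le> \<bar>A j ?m\<bar>"
    obtain B where B: "B \<in> M" "\<bar>B i ?m\<bar> < \<bar>A i ?m\<bar>" "\<And>r c. r \<noteq> i \<Longrightarrow> B r c = A r c"
      "\<And>c. A j c = 0 \<Longrightarrow> B i c = A i c"
    proof (cases "A i ?m > 0 \<longleftrightarrow> A j ?m > 0")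
      case True
      then have "\<bar>A i ?m - 2 * A j ?m\<bar> < \<bar>A i ?m\<bar>"
        using gt ij(5) by linarith
      then show thesis
        using that[OF subtract_row[OF A(1) ij(1-3)]] by simp
    next
      case False
      then have "\<bar>A i ?m + 2 * A j ?m\<bar> < \<bar>A i ?m\<bar>"
        using gt ij(5) by linarith
      then show thesis
        using that[OF add_row[OF A(1) ij(1-3)]] by simp
    qed
    have "A j c = 0" if "c \<in> {1..k}" for c
      using A(2) ij that by (auto simp: identity_columns_def)
    then have "identity_columns k B"
      using A(2) B(3,4) unfolding identity_columns_def by metis
    moreover have "?size B < ?size A"
    proof (rule sum_strict_mono_ex1)
      show "\<forall>r \<in> {1..n}. nat \<bar>B r ?m\<bar> \<le> nat \<bar>A r ?m\<bar>"
        using B(2,3) by (metis abs_ge_zero nat_mono less_imp_le order_refl)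
      show "\<exists>r \<in> {1..n}. nat \<bar>B r ?m\<bar> < nat \<bar>A r ?m\<bar>"
        using B(2) ij(1) by (intro bexI[of _ i]) auto
    qed simp
    ultimately show False
      using least[OF B(1)] by simp
  qed
  obtain c where c: "\<And>j. j \<in> {1..n} \<Longrightarrow> (\<Sum>i = 1..n. c i * A i j) = of_bool (j = ?m)"
  proof -
    have "?m \<in> {1..n}"
      using k by simp
    from rows_span[OF A(1) this] show thesis
      using that by blast
  qed
  \<comment> \<open>The first \<open>k\<close> rows do not contribute, as column \<open>j \<le> k\<close> is the \<open>j\<close>-th unit vector.\<close>
  have c0: "c j = 0" if "j \<in> {1..k}" for j
  proof -
    have "(\<Sum>i = 1..n. c i * A i j) = (\<Sum>i = 1..n. if i = j then c i else 0)"
      using A(2) that by (intro sum.cong) (auto simp: identity_columns_def)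
    also have "\<dots> = c j"
      using that k by simp
    finally show ?thesis
      using c[of j] that k by simp
  qed
  have one: "(\<Sum>i = 1..n. c i * A i ?m) = 1"
    using c[of ?m] k by simp
  obtain p where p: "p \<in> {k<..n}" "A p ?m \<noteq> 0"
  proof (rule ccontr)
    assume "\<not> thesis"
    then have "\<forall>i \<in> {1..n}. c i * A i ?m = 0"
      using that c0 by (metis atLeastAtMost_iff greaterThanAtMost_iff mult_eq_0_iff not_le)
    then have "(\<Sum>i = 1..n. c i * A i ?m) = 0"
      by (intro sum.neutral)
    then show False
      using one by simp
  qed
  \<comment> \<open>By minimality, nonzero entries below row \<open>k\<close> have equal absolute values, and their integer
    combination \<open>one\<close> shows that this value is 1.\<close>
  have "A p ?m dvd A i ?m" if "i \<in> {k<..n}" for i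
  proof (cases "A i ?m = 0 \<or> i = p")
    case False
    then have "\<bar>A i ?m\<bar> = \<bar>A p ?m\<bar>"
      using p that by (intro antisym minimal) auto
    then show ?thesis
      by (metis abs_dvd_iff dvd_refl dvd_abs_iff)
  qed auto
  then have "A p ?m dvd c i * A i ?m" if "i \<in> {1..n}" for i
    using that c0[of i] by (cases "i \<le> k") auto
  then have "A p ?m dvd 1"
    unfolding one[symmetric] by (intro dvd_sum)
  then have p1: "\<bar>A p ?m\<bar> = 1"
    by simp
  \<comment> \<open>By minimality another nonzero entry would be \<open>\<plusminus>1\<close> too, making two odd entries in one column.\<close>
  have "A i ?m = 0" if i: "i \<in> {1..n}" "i \<noteq> p" for i
  proof (rule ccontr)
    assume "A i ?m \<noteq> 0"
    moreover have "\<bar>A i ?m\<bar> \<le> 1"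
      using minimal[OF i(1) _ i(2)] p p1 by auto
    ultimately have "\<bar>A i ?m\<bar> = 1"
      by simp
    then have "odd (A i ?m)" "odd (A p ?m)"
      using p1 by (metis dvd_abs_iff odd_one)+
    then show False
      using column_odd_unique[OF A(1), of i p ?m] i p k by auto
  qed
  then show ?thesis
    using A p(1) p1 by blast
qed

lemma extend_identity_columns:
  assumes k: "k < n" and ex: "\<exists>A \<in> M. identity_columns k A"
  shows "\<exists>A \<in> M. identity_columns (k + 1) A"
proof -
  let ?m = "k + 1"
  obtain A p where A: "A \<in> M" "identity_columns k A" and p: "p \<in> {k<..n}"
    and p1: "\<bar>A p ?m\<bar> = 1" and zero: "\<forall>i \<in> {1..n}. i \<noteq> p \<longrightarrow> A i ?m = 0"
    using clear_column[OF assms] by blast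
  have "\<forall>i \<in> {1..n}. A i ?m = A p ?m * of_bool (i = p)"
    using zero by auto
  then obtain B where B: "B \<in> M" "identity_columns k B"
    "\<forall>i \<in> {1..n}. B i ?m = A p ?m * of_bool (i = ?m)"
    using move_pivot[OF _ _ A] p by (metis Suc_eq_plus1 Suc_leI greaterThanAtMost_iff)
  let ?C = "B(?m := \<lambda>c. - B ?m c)"
  consider "A p ?m = 1" | "A p ?m = -1"
    using p1 by linarith
  then show ?thesis
  proof cases
    case 1
    then have "identity_columns ?m B"
      using B unfolding identity_columns_Suc by simp
    then show ?thesis using B by blast
  next
    case 2
    have "identity_columns k ?C"
      using B(2) by (auto simp: identity_columns_def)
    then have "identity_columns ?m ?C"
      using B(3) 2 unfolding identity_columns_Suc by simp
    moreover have "?C \<in> M"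
      using B k by (intro negate_row) auto
    ultimately show ?thesis by blast
  qed
qed

theorem identity_reached:
  assumes "M \<noteq> {}"
  shows "\<exists>A \<in> M. \<forall>i \<in> {1..n}. \<forall>j \<in> {1..n}. A i j = of_bool (i = j)"
proof -
  have "\<exists>A \<in> M. identity_columns k A" if "k \<le> n" for k
    using that
  proof (induction k)
    case 0
    then show ?case
      using assms by (auto simp: identity_columns_def)
  next
    case (Suc k)
    then show ?case
      using extend_identity_columns[of k] by simp
  qed
  then show ?thesis
    by (auto simp: identity_columns_def)
qed

end

section \<open>Generation by elementary automorphisms\<close>

definition elementary_auts :: "nat \<Rightarrow> (word set \<Rightarrow> word set) set" where
  "elementary_auts n = {t_aut n i | i. i \<in> {1..n}}
     \<union> {alpha_aut n l | l. l \<in> {1..<n}}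
     \<union> {mu_aut n i j | i j. i \<in> {1..n} \<and> j \<in> {1..n} \<and> i \<noteq> j}"

text \<open>Closure of the palindromic automorphisms under inverses is not immediate, but the inverse of each
  elementary automorphism is palindromic by an explicit formula, and this suffices.\<close>

lemma generate_subset_palindromic_auts:
  "generate (AutoGroup (free_nil2 n)) (elementary_auts n) \<subseteq> palindromic_auts n"
proof
  fix \<phi> assume "\<phi> \<in> generate (AutoGroup (free_nil2 n)) (elementary_auts n)"
  then show "\<phi> \<in> palindromic_auts n"
  proof (induction rule: generate.induct)
    case one
    have "(\<lambda>x \<in> carrier (free_nil2 n). x) \<in> auto (free_nil2 n)"
      by (rule group.id_in_auto[OF group_free_nil2])
    moreover have "palindrome n ((\<lambda>x \<in> carrier (free_nil2 n). x) (gen n i))" if "i \<in> {1..n}" for i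
      using that by (simp add: palindrome_gen)
    ultimately show ?case
      unfolding palindromic_auts_def one_AutoGroup by blast
  next
    case (incl h)
    then show ?case
      by (auto simp: elementary_auts_def t_aut alpha_aut mu_aut)
  next
    case (inv h)
    then show ?case
      by (auto simp: elementary_auts_def t_aut alpha_aut mu_aut)
  next
    case (eng h1 h2)
    then show ?case
      by (intro palindromic_auts_mult)
  qed
qed

text \<open>Row \<open>i\<close> is the image of the \<open>i\<close>-th basis vector of the abelianisation, so composing \<open>\<psi>\<close> with a further
  automorphism on the right acts on rows.\<close>

definition exponent_matrix :: "nat \<Rightarrow> (word set \<Rightarrow> word set) \<Rightarrow> nat \<Rightarrow> nat \<Rightarrow> int" where
  "exponent_matrix n \<psi> i j = nil_exponent n j (\<psi> (gen n i))"

text \<open>The coefficients are the exponent sums of a preimage of \<open>x\<^sub>j\<close>.\<close>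

lemma exponent_matrix_rows_span:
  assumes \<psi>: "\<psi> \<in> auto (free_nil2 n)" and j: "j \<in> {1..n}"
  shows "\<exists>c. \<forall>j' \<in> {1..n}. (\<Sum>i = 1..n. c i * exponent_matrix n \<psi> i j') = of_bool (j' = j)"
proof -
  interpret Z: group integer_group by simp
  obtain x where "x \<in> carrier (free_nil2 n)" "gen n j = \<psi> x"
    using auto_surj[OF \<psi>, of "gen n j"] j by auto
  then obtain w where w: "w \<in> words n" "gen n j = \<psi> (repr n w)"
    by (auto simp: carrier_free_nil2)
  have "(\<Sum>i = 1..n. exponent i w * exponent_matrix n \<psi> i j') = of_bool (j' = j)" if j': "j' \<in> {1..n}" for j'
  proof -
    have "nil_exponent n j' (gen n j) = (nil_exponent n j' \<circ> \<psi>) (repr n w)"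
      using w by simp
    also have "\<dots> = Z.word_val (nil_exponent n j' \<circ> \<psi> \<circ> gen n) w"
      by (rule hom_repr[OF Z.is_group hom_compose[OF auto_hom[OF \<psi>] nil_exponent_hom[OF j']] w(1)])
    also have "\<dots> = (\<Sum>i = 1..n. exponent i w * exponent_matrix n \<psi> i j')"
      using w(1) by (simp add: word_val_integer_group exponent_matrix_def)
    finally show ?thesis
      using j j' by (cases "j' = j") (simp_all add: nil_exponent_repr exponent_Cons)
  qed
  then show ?thesis
    by (intro exI[of _ "\<lambda>i. exponent i w"] ballI)
qed

lemma exponent_matrix_row_odd_unique:
  assumes "\<psi> \<in> palindromic_auts n" "i \<in> {1..n}" "j \<in> {1..n}" "j' \<in> {1..n}"
    and "odd (exponent_matrix n \<psi> i j)" "odd (exponent_matrix n \<psi> i j')"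
  shows "j = j'"
proof -
  obtain w where "w \<in> words n" "rev w = w" "\<psi> (gen n i) = repr n w"
    using assms(1,2) unfolding palindromic_auts_def palindrome_def by blast
  then show ?thesis
    using assms palindrome_odd_exponent_unique[of w j j'] by (simp add: exponent_matrix_def nil_exponent_repr)
qed

lemma palindromic_aut_eq_one:
  assumes \<psi>: "\<psi> \<in> palindromic_auts n"
    and matrix: "\<And>i j. \<lbrakk>i \<in> {1..n}; j \<in> {1..n}\<rbrakk> \<Longrightarrow> exponent_matrix n \<psi> i j = of_bool (i = j)"
  shows "\<psi> = \<one>\<^bsub>AutoGroup (free_nil2 n)\<^esub>"
proof (rule auto_eqI)
  interpret N: group "free_nil2 n" by (rule group_free_nil2)
  show "\<psi> \<in> auto (free_nil2 n)"
    using \<psi> by (simp add: palindromic_auts_def)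
  show "\<one>\<^bsub>AutoGroup (free_nil2 n)\<^esub> \<in> auto (free_nil2 n)"
    unfolding one_AutoGroup by (rule N.id_in_auto)
  fix k assume k: "k \<in> {1..n}"
  obtain w where w: "w \<in> words n" "rev w = w" "\<psi> (gen n k) = repr n w"
    using \<psi> k unfolding palindromic_auts_def palindrome_def by blast
  have "exponent j w = of_bool (j = k)" if "j \<in> {1..n}" for j
    using matrix[OF k that] w that by (auto simp: exponent_matrix_def nil_exponent_repr)
  then have "repr n w = gen n k"
    using N.palindrome_word_val[OF central_commutators_free_nil2 gen_closed k w(1,2)] w(1)
    by (simp add: repr_eq_word_val)
  then show "\<psi> (gen n k) = \<one>\<^bsub>AutoGroup (free_nil2 n)\<^esub> (gen n k)"
    using w k by (simp add: one_AutoGroup)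
qed

lemma exponent_matrix_mult_elementary:
  assumes \<psi>: "\<psi> \<in> auto (free_nil2 n)" and k: "k \<in> {1..n}" and c: "c \<in> {1..n}"
  shows exponent_matrix_mult_t: "i \<in> {1..n} \<Longrightarrow>
      exponent_matrix n (\<psi> \<otimes>\<^bsub>AutoGroup (free_nil2 n)\<^esub> t_aut n i) k c =
      (if k = i then - exponent_matrix n \<psi> i c else exponent_matrix n \<psi> k c)"
    and exponent_matrix_mult_alpha: "l \<in> {1..<n} \<Longrightarrow>
      exponent_matrix n (\<psi> \<otimes>\<^bsub>AutoGroup (free_nil2 n)\<^esub> alpha_aut n l) k c =
      (if k = l then exponent_matrix n \<psi> (l + 1) c
       else if k = l + 1 then exponent_matrix n \<psi> l c else exponent_matrix n \<psi> k c)"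
    and exponent_matrix_mult_mu: "\<lbrakk>i \<in> {1..n}; j \<in> {1..n}; i \<noteq> j\<rbrakk> \<Longrightarrow>
      exponent_matrix n (\<psi> \<otimes>\<^bsub>AutoGroup (free_nil2 n)\<^esub> mu_aut n i j) k c =
      (if k = i then exponent_matrix n \<psi> i c + 2 * exponent_matrix n \<psi> j c else exponent_matrix n \<psi> k c)"
proof -
  interpret N: group "free_nil2 n" by (rule group_free_nil2)
  interpret \<psi>: group_hom "free_nil2 n" "free_nil2 n" \<psi>
    by unfold_locales (rule auto_hom[OF \<psi>])
  interpret e: group_hom "free_nil2 n" integer_group "nil_exponent n c"
    by (simp add: group_hom_def group_hom_axioms_def N.is_group nil_exponent_hom[OF c])
  have image: "exponent_matrix n (\<psi> \<otimes>\<^bsub>AutoGroup (free_nil2 n)\<^esub> g) k c = nil_exponent n c (\<psi> (g (gen n k)))"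
    if "g \<in> palindromic_auts n" for g
    using that \<psi> k by (simp add: exponent_matrix_def mult_AutoGroup_apply palindromic_auts_def)
  show "exponent_matrix n (\<psi> \<otimes>\<^bsub>AutoGroup (free_nil2 n)\<^esub> t_aut n i) k c =
      (if k = i then - exponent_matrix n \<psi> i c else exponent_matrix n \<psi> k c)" if "i \<in> {1..n}"
    unfolding image[OF t_aut_palindromic[OF that]] using that k
    by (simp add: t_aut_gen exponent_matrix_def)
  show "exponent_matrix n (\<psi> \<otimes>\<^bsub>AutoGroup (free_nil2 n)\<^esub> alpha_aut n l) k c =
      (if k = l then exponent_matrix n \<psi> (l + 1) c
       else if k = l + 1 then exponent_matrix n \<psi> l c else exponent_matrix n \<psi> k c)" if "l \<in> {1..<n}"
    unfolding image[OF alpha_aut_palindromic[OF that]] using that k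
    by (simp add: alpha_aut_gen exponent_matrix_def)
  show "exponent_matrix n (\<psi> \<otimes>\<^bsub>AutoGroup (free_nil2 n)\<^esub> mu_aut n i j) k c =
      (if k = i then exponent_matrix n \<psi> i c + 2 * exponent_matrix n \<psi> j c else exponent_matrix n \<psi> k c)"
    if "i \<in> {1..n}" "j \<in> {1..n}" "i \<noteq> j"
    unfolding image[OF mu_aut_palindromic[OF that]] using that k
    by (simp add: mu_aut_gen exponent_matrix_def)
qed

text \<open>Row reduction is applied to the matrices of the left coset \<open>C = \<phi> H\<close> of the generated subgroup \<open>H\<close>. The
  identity matrix occurs among them, so the coset contains the identity, and \<open>\<phi>\<close> lies in \<open>H\<close>.\<close>

lemma palindromic_auts_subset_generate:
  "palindromic_auts n \<subseteq> generate (AutoGroup (free_nil2 n)) (elementary_auts n)"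
proof
  interpret AG: group "AutoGroup (free_nil2 n)" by (rule group_AutoGroup_nil2)
  let ?H = "generate (AutoGroup (free_nil2 n)) (elementary_auts n)"
  fix \<phi> assume \<phi>: "\<phi> \<in> palindromic_auts n"
  have auto: "\<psi> \<in> auto (free_nil2 n)" if "\<psi> \<in> palindromic_auts n" for \<psi>
    using that by (simp add: palindromic_auts_def)
  define C where "C = {\<phi> \<otimes>\<^bsub>AutoGroup (free_nil2 n)\<^esub> h | h. h \<in> ?H}"
  have C_pal: "C \<subseteq> palindromic_auts n"
    using \<phi> generate_subset_palindromic_auts by (auto simp: C_def intro: palindromic_auts_mult)
  have C_mult: "\<psi> \<otimes>\<^bsub>AutoGroup (free_nil2 n)\<^esub> g \<in> C" if "\<psi> \<in> C" "g \<in> elementary_auts n" for \<psi> g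
  proof -
    obtain h where h: "h \<in> ?H" "\<psi> = \<phi> \<otimes>\<^bsub>AutoGroup (free_nil2 n)\<^esub> h"
      using \<open>\<psi> \<in> C\<close> by (auto simp: C_def)
    have g: "g \<in> ?H"
      using that(2) by (rule generate.incl)
    have "\<phi> \<in> auto (free_nil2 n)" "h \<in> auto (free_nil2 n)" "g \<in> auto (free_nil2 n)"
      using \<phi> h(1) g generate_subset_palindromic_auts by (blast intro: auto)+
    then have "\<psi> \<otimes>\<^bsub>AutoGroup (free_nil2 n)\<^esub> g = \<phi> \<otimes>\<^bsub>AutoGroup (free_nil2 n)\<^esub> (h \<otimes>\<^bsub>AutoGroup (free_nil2 n)\<^esub> g)"
      unfolding h(2) by (intro AG.m_assoc) simp_all
    then show ?thesis
      using generate.eng[OF h(1) g] by (auto simp: C_def)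
  qed
  define M where "M = {A. \<exists>\<psi> \<in> C. \<forall>i \<in> {1..n}. \<forall>j \<in> {1..n}. A i j = exponent_matrix n \<psi> i j}"
  have M_step: "B \<in> M" if "\<psi> \<in> C" "g \<in> elementary_auts n"
    "\<And>i j. \<lbrakk>i \<in> {1..n}; j \<in> {1..n}\<rbrakk> \<Longrightarrow> B i j = exponent_matrix n (\<psi> \<otimes>\<^bsub>AutoGroup (free_nil2 n)\<^esub> g) i j" for B \<psi> g
    using C_mult[OF that(1,2)] that(3) unfolding M_def by blast
  interpret row_stable n M
  proof
    fix A assume "A \<in> M"
    then obtain \<psi> where \<psi>C: "\<psi> \<in> C" and A: "\<And>i j. \<lbrakk>i \<in> {1..n}; j \<in> {1..n}\<rbrakk> \<Longrightarrow> A i j = exponent_matrix n \<psi> i j"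
      unfolding M_def by blast
    have \<psi>: "\<psi> \<in> palindromic_auts n"
      using \<psi>C C_pal by blast
    note mult = exponent_matrix_mult_elementary[OF auto[OF \<psi>]]
    show "A(i := \<lambda>c. A i c + 2 * A j c) \<in> M" if "i \<in> {1..n}" "j \<in> {1..n}" "i \<noteq> j" for i j
      using that by (intro M_step[OF \<psi>C, of "mu_aut n i j"]) (auto simp: elementary_auts_def A mult)
    show "A(i := \<lambda>c. - A i c) \<in> M" if "i \<in> {1..n}" for i
      using that by (intro M_step[OF \<psi>C, of "t_aut n i"]) (auto simp: elementary_auts_def A mult)
    show "A(l := A (l + 1), l + 1 := A l) \<in> M" if "l \<in> {1..<n}" for l
      using that by (intro M_step[OF \<psi>C, of "alpha_aut n l"]) (auto simp: elementary_auts_def A mult)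
    show "j = j'" if "i \<in> {1..n}" "j \<in> {1..n}" "j' \<in> {1..n}" "odd (A i j)" "odd (A i j')" for i j j'
      using that(4,5) unfolding A[OF that(1,2)] A[OF that(1,3)]
      by (rule exponent_matrix_row_odd_unique[OF \<psi> that(1-3)])
    show "\<exists>c. \<forall>j' \<in> {1..n}. (\<Sum>i = 1..n. c i * A i j') = of_bool (j' = j)" if "j \<in> {1..n}" for j
      using exponent_matrix_rows_span[OF auto[OF \<psi>] that] by (simp add: A)
  qed
  have "\<phi> \<otimes>\<^bsub>AutoGroup (free_nil2 n)\<^esub> \<one>\<^bsub>AutoGroup (free_nil2 n)\<^esub> \<in> C"
    unfolding C_def using generate.one by blast
  then have "M \<noteq> {}"
    unfolding M_def by blast
  from identity_reached[OF this] obtain h where h: "h \<in> ?H"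
    and id: "\<And>i j. \<lbrakk>i \<in> {1..n}; j \<in> {1..n}\<rbrakk> \<Longrightarrow>
      exponent_matrix n (\<phi> \<otimes>\<^bsub>AutoGroup (free_nil2 n)\<^esub> h) i j = of_bool (i = j)"
    unfolding M_def C_def by auto
  have hauto: "h \<in> auto (free_nil2 n)"
    using h generate_subset_palindromic_auts auto by blast
  have "\<phi> \<otimes>\<^bsub>AutoGroup (free_nil2 n)\<^esub> h \<in> palindromic_auts n"
    using C_pal h by (auto simp: C_def)
  then have "\<phi> \<otimes>\<^bsub>AutoGroup (free_nil2 n)\<^esub> h = \<one>\<^bsub>AutoGroup (free_nil2 n)\<^esub>"
    using id by (rule palindromic_aut_eq_one)
  then have "\<phi> = inv\<^bsub>AutoGroup (free_nil2 n)\<^esub> h"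
    using hauto auto[OF \<phi>] by (intro AG.inv_equality[symmetric]) simp_all
  moreover have "elementary_auts n \<subseteq> carrier (AutoGroup (free_nil2 n))"
    using generate_subset_palindromic_auts auto generate.incl by fastforce
  ultimately show "\<phi> \<in> ?H"
    using AG.generate_m_inv_closed[OF _ h] by simp
qed

theorem proposition3p2:
  fixes n :: nat
  shows "generate (AutoGroup (free_nil2 n))
           ({t_aut n i | i. i \<in> {1..n}}
            \<union> {alpha_aut n l | l. l \<in> {1..<n}}
            \<union> {mu_aut n i j | i j. i \<in> {1..n} \<and> j \<in> {1..n} \<and> i \<noteq> j})
         = palindromic_auts n"
  by (rule subset_antisym[OF generate_subset_palindromic_auts palindromic_auts_subset_generate,
        unfolded elementary_auts_def])

end
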